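(* Assume that, for all $i,j\in\{1,\dots,k\}$, as $n\to\infty$: $n_n^{(i)}/n_n^{(j)}\to\nu_{ij}\in(0,\infty)$; $1/n_n^{(i)}\ll p_n^{(i)}\lesssim (n_n^{(i)})^{-1/r'}$ for some $r'\in(1,r)$; $q_n^{(ij)}\le\min\{p_n^{(i)},p_n^{(j)}\}$ for all $n$; $q_n^{(ij)}/p_n^{(i)}\to\gamma_{ij}\in[0,1]$ and $p_n^{(i)}/p_n^{(j)}\to\mu_{ij}\in(0,\infty)$; $a_n^{(i)}/g_n^{(i)}\to\alpha_i\ge 0$; the matrix $\chi=(\chi_{ij})_{1\le i,j\le k}$ is irreducible; and $\alpha_1\ge\alpha_2\ge\dots\ge\alpha_k$ with $\alpha_1>0$. Assume moreover the super-critical condition $$\min_{x\in\mathcal D_\rho}\rho_1(x)>0$$ (with the convention $\min\emptyset=+\infty$). Then $$\lim_{n\to\infty}\frac{A_n^*}{n}=1\quad\text{almost surely}.$$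
   Context: Fix integers $r\ge2$ and $k\ge1$. All limits are as $n\to\infty$; $f_1\ll f_2$ means $f_1(n)/f_2(n)\to0$; $f_1\lesssim f_2$ means that either $f_1\ll f_2$ or $f_1(n)/f_2(n)\to1$. Stochastic block model: for each $n$, a random graph on $n$ nodes partitioned into communities $G_1,\dots,G_k$ of sizes $n_n^{(1)},\dots,n_n^{(k)}\in\{1,2,\dots\}$, $\sum_i n_n^{(i)}=n$. Each pair of distinct nodes, one in $G_i$ and the other in $G_j$ (possibly $i=j$), is joined by an edge independently of the other pairs with probability $q_n^{(ij)}=q_n^{(ji)}\in[0,1)$. Put $p_n^{(i)}:=q_n^{(ii)}$. The models for different $n$ are defined on a common probability space (no assumption is made on their joint law). Bootstrap percolation: in each $G_i$, a set of $a_n^{(i)}$ nodes ($0\le a_n^{(i)}\le n_n^{(i)}$), called seeds, is chosen uniformly at random and declared active; all other nodes are initially inactive. An inactive node becomes active as soon as at least $r$ of its neighbours are active; active nodes stay active forever. The process stops when no more nodes can be activated. $A_n^*$ is the final number of active nodes (seeds included). Definitions: $g_n^{(i)}:=\left(1-\frac1r\right)\left(\frac{(r-1)!}{n_n^{(i)}(p_n^{(i)})^r}\right)^{1/(r-1)}$; $\chi_{ij}:=\lim_{n\to\infty}\frac{q_n^{(ij)}g_n^{(j)}}{p_n^{(i)}g_n^{(i)}}=\gamma_{ij}(\nu_{ij}(\mu_{ij})^r)^{1/(r-1)}$ (so $\chi_{ii}=1$). For $x\in[0,\infty)^k$ and $1\le i\le k$, $$\rho_i(x):=\alpha_i-x_i+r^{-1}(1-r^{-1})^{r-1}\Bigl(\sum_{j=1}^k\chi_{ij}x_j\Bigr)^r.$$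 $\mathcal D:=\{x\in[0,r/(r-1)]^k: x_i+\sum_{j\ne i}\chi_{ij}x_j\le r/(r-1)\ \forall i\}$ and $\mathcal D_\rho:=\{x\in\mathcal D:\rho_1(x)=\dots=\rho_k(x)\}$. *)

theory Defs
  imports "HOL-Probability.Probability" "HOL-Probability.Product_PMF" "HOL-Library.Landau_Symbols"
begin

text \<open>
  The model with \<open>n\<close> nodes has node set \<open>{..<n}\<close>. The partition into communities \<open>1, \<dots>, k\<close> is given by
  a labelling \<open>c\<close>, where \<open>c v\<close> is the community of the node \<open>v\<close>.
\<close>

definition community :: "nat \<Rightarrow> (nat \<Rightarrow> nat) \<Rightarrow> nat \<Rightarrow> nat set" where
  "community n c i = {v. v < n \<and> c v = i}"

text \<open>
  A graph on \<open>{..<n}\<close> is encoded by a function \<open>h\<close> on ordered pairs; only the values \<open>h (u, v)\<close> with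
  \<open>u < v < n\<close> matter, so that each unordered pair of distinct nodes is represented once. As \<open>q\<close> is
  assumed symmetric where this is used, the choice of the representative is immaterial.
\<close>

definition sbm_pmf :: "nat \<Rightarrow> (nat \<Rightarrow> nat) \<Rightarrow> (nat \<Rightarrow> nat \<Rightarrow> real) \<Rightarrow> (nat \<times> nat \<Rightarrow> bool) pmf" where
  "sbm_pmf n c q =
     Pi_pmf {(u, v). u < v \<and> v < n} False (\<lambda>(u, v). bernoulli_pmf (q (c u) (c v)))"

definition seeds_pmf ::
  "nat \<Rightarrow> nat \<Rightarrow> (nat \<Rightarrow> nat) \<Rightarrow> (nat \<Rightarrow> nat) \<Rightarrow> (nat \<Rightarrow> nat set) pmf" where
  "seeds_pmf n k c a =
     Pi_pmf {1..k} {} (\<lambda>i. pmf_of_set {T. T \<subseteq> community n c i \<and> card T = a i})"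

text \<open>The seeds are chosen independently of the graph.\<close>

definition percolation_pmf ::
  "nat \<Rightarrow> nat \<Rightarrow> (nat \<Rightarrow> nat) \<Rightarrow> (nat \<Rightarrow> nat \<Rightarrow> real) \<Rightarrow> (nat \<Rightarrow> nat)
     \<Rightarrow> ((nat \<times> nat \<Rightarrow> bool) \<times> (nat \<Rightarrow> nat set)) pmf" where
  "percolation_pmf n k c q a = pair_pmf (sbm_pmf n c q) (seeds_pmf n k c a)"

definition adjacent :: "(nat \<times> nat \<Rightarrow> bool) \<Rightarrow> nat \<Rightarrow> nat \<Rightarrow> bool" where
  "adjacent h u v \<longleftrightarrow> (u < v \<and> h (u, v)) \<or> (v < u \<and> h (v, u))"

definition percolation_step ::
  "nat \<Rightarrow> nat \<Rightarrow> (nat \<times> nat \<Rightarrow> bool) \<Rightarrow> nat set \<Rightarrow> nat set" where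
  "percolation_step r n h A = A \<union> {v. v < n \<and> r \<le> card {u \<in> A. adjacent h u v}}"

text \<open>
  All nodes that can be activated are activated in each round. The rounds increase and become
  stationary, so their union is the final set of active nodes.
\<close>

definition final_active ::
  "nat \<Rightarrow> nat \<Rightarrow> (nat \<times> nat \<Rightarrow> bool) \<Rightarrow> nat set \<Rightarrow> nat set" where
  "final_active r n h A = (\<Union>t. (percolation_step r n h ^^ t) A)"

text \<open>The number \<open>g\<close> for a community with \<open>m\<close> nodes and internal edge probability \<open>p\<close>.\<close>

definition critical_seeds :: "nat \<Rightarrow> nat \<Rightarrow> real \<Rightarrow> real" where
  "critical_seeds r m p =
     (1 - 1 / real r) * (fact (r - 1) / (real m * p ^ r)) powr (1 / (real r - 1))"

text \<open>Not permutation-similar to a block triangular matrix with two nonempty diagonal blocks.\<close>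

definition irreducible_matrix :: "nat \<Rightarrow> (nat \<Rightarrow> nat \<Rightarrow> real) \<Rightarrow> bool" where
  "irreducible_matrix k A \<longleftrightarrow>
     \<not> (\<exists>I J. I \<noteq> {} \<and> J \<noteq> {} \<and> I \<inter> J = {} \<and> I \<union> J = {1..k} \<and> (\<forall>i\<in>I. \<forall>j\<in>J. A i j = 0))"

definition rho ::
  "nat \<Rightarrow> nat \<Rightarrow> (nat \<Rightarrow> real) \<Rightarrow> (nat \<Rightarrow> nat \<Rightarrow> real) \<Rightarrow> nat \<Rightarrow> (nat \<Rightarrow> real) \<Rightarrow> real" where
  "rho r k \<alpha> chi i x =
     \<alpha> i - x i + (1 / real r) * (1 - 1 / real r) ^ (r - 1) * (\<Sum>j\<in>{1..k}. chi i j * x j) ^ r"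

text \<open>Vectors of length \<open>k\<close> are extensional functions on \<open>{1..k}\<close>.\<close>

definition region :: "nat \<Rightarrow> nat \<Rightarrow> (nat \<Rightarrow> nat \<Rightarrow> real) \<Rightarrow> (nat \<Rightarrow> real) set" where
  "region r k chi =
     {x \<in> {1..k} \<rightarrow>\<^sub>E {0..real r / (real r - 1)}.
        \<forall>i\<in>{1..k}. x i + (\<Sum>j\<in>{1..k} - {i}. chi i j * x j) \<le> real r / (real r - 1)}"

definition region_rho ::
  "nat \<Rightarrow> nat \<Rightarrow> (nat \<Rightarrow> real) \<Rightarrow> (nat \<Rightarrow> nat \<Rightarrow> real) \<Rightarrow> (nat \<Rightarrow> real) set" where
  "region_rho r k \<alpha> chi =
     {x \<in> region r k chi. \<forall>i\<in>{1..k}. \<forall>j\<in>{1..k}. rho r k \<alpha> chi i x = rho r k \<alpha> chi j x}"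

text \<open>
  As \<open>region_rho\<close> is compact, the infimum is a minimum if the set is nonempty; otherwise its value
  in the extended reals is \<open>\<infinity>\<close>.
\<close>

definition min_rho :: "nat \<Rightarrow> nat \<Rightarrow> (nat \<Rightarrow> real) \<Rightarrow> (nat \<Rightarrow> nat \<Rightarrow> real) \<Rightarrow> ereal" where
  "min_rho r k \<alpha> chi = (INF x\<in>region_rho r k \<alpha> chi. ereal (rho r k \<alpha> chi 1 x))"

end

theory Submission
  imports Defs "HOL-Real_Asymp.Real_Asymp"
begin

text \<open>
  Activate the nodes one at a time and reveal the edges of a node only when it is used. If \<open>T j\<close> nodes of
  each community \<open>j\<close> have been used, every node \<open>v\<close> has received a number of marks that is a sum of
  independent Bernoulli variables, independently for different \<open>v\<close>, and the process can only stop at a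
  vector \<open>T\<close> such that in each community \<open>i\<close> the seeds and the nodes with at least \<open>r\<close> marks number at
  most \<open>T i\<close>. The number of these nodes is monotone in \<open>T\<close>, so only lower tails at deterministic \<open>T\<close> matter.

  On the scale \<open>T i = x i g i\<close> the expected number is \<open>g i \<Phi> i x\<close>, where
  \<open>\<Phi> i x = \<alpha> i + r\<^bsup>-1\<^esup> (1 - r\<^bsup>-1\<^esup>)\<^bsup>r-1\<^esup> (\<Sum>j. chi i j x j)\<^bsup>r\<^esup>\<close>. If the iterates of \<open>\<Phi>\<close> from \<open>0\<close> were
  bounded, they would converge to the least fixed point of \<open>\<Phi>\<close>, which lies in \<open>region\<close> and is a common
  zero of the \<open>rho i\<close>, contradicting super-criticality. So they are unbounded, in every coordinate
  by irreducibility, and finitely many slightly damped iterations, each failing with probability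
  \<open>exp (- d g)\<close>, lead beyond any multiple of \<open>g\<close>. From there each community alone activates almost all of
  its nodes. As \<open>g\<close> grows like a power of \<open>n\<close>, the error probabilities are summable.
\<close>

text \<open>The obstacle is that the order of exploration depends on the graph, so the marks present
  when the process stops have no simple law. Therefore the array gives every node a full supply of
  independent cells, even where no edge corresponds to a cell, and an unknown stopping vector is
  compared with fixed ones. Only nodes outside the final active set need correct marks, so one
  inclusion suffices.

  The constants come from one equation, \<open>N p^r g^(r-1) = (1 - 1/r)^(r-1) (r-1)!\<close>. If
  the marks of a node have mean \<open>p g s\<close>, about \<open>N (p g s)^r / r!\<close> nodes
  collect \<open>r\<close> marks, and this is \<open>r^(-1) (1 - 1/r)^(r-1) s^r g\<close>. The
  derivative of the coefficient in \<open>s\<close> reaches 1 at \<open>s = r/(r-1)\<close>, the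
  bound in \<open>region\<close>.

  Damping pays for random deviations and rounding; neither its factor nor the number of rounds
  depends on \<open>n\<close>. The growth of \<open>g\<close> comes from \<open>r' < r\<close>,
  which bounds \<open>N p^r\<close> by a negative power of \<open>n\<close>. Summability is needed
  because nothing links the models for different \<open>n\<close>.\<close>

section \<open>Independent Bernoulli variables\<close>

lemma exp_minus_le_quadratic:
  fixes s :: real
  assumes "0 \<le> s"
  shows "exp (- s) \<le> 1 - s + s\<^sup>2 / 2"
proof -
  have "exp (- 0) - (1 - 0 + 0\<^sup>2 / 2) \<ge> exp (- s) - (1 - s + s\<^sup>2 / (2::real))"
  proof (rule DERIV_nonpos_imp_nonincreasing[OF assms])
    fix x :: real assume "0 \<le> x" "x \<le> s"
    have "((\<lambda>s. exp (- s) - (1 - s + s\<^sup>2 / 2)) has_real_derivative - exp (- x) + 1 - x) (at x)"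
      by (auto intro!: derivative_eq_intros)
    moreover have "- exp (- x) + 1 - x \<le> 0"
      using exp_ge_add_one_self[of "- x"] by simp
    ultimately show "\<exists>y. ((\<lambda>s. exp (- s) - (1 - s + s\<^sup>2 / 2)) has_real_derivative y) (at x) \<and> y \<le> 0"
      by blast
  qed
  then show ?thesis by simp
qed

text \<open>Markov's inequality for \<open>exp (- \<delta> * count)\<close>. Taking
  \<open>\<delta>\<close> itself as the exponent, instead of the optimal
  \<open>- ln (1 - \<delta>)\<close>, still gives the rate \<open>\<delta>^2 / 2\<close> by
  \<open>exp_minus_le_quadratic\<close>. The predicate may vary with the index, so that counts over
  a subset of \<open>V\<close> are covered.\<close>

lemma Pi_pmf_chernoff_lower:
  fixes P :: "'a \<Rightarrow> 'b pmf"
  assumes "finite V" and "0 \<le> \<delta>" and "m \<ge> 0"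
    and m: "m \<le> (\<Sum>v\<in>V. measure_pmf.prob (P v) {y. Q v y})"
  shows "measure_pmf.prob (Pi_pmf V d P) {f. real (card {v \<in> V. Q v (f v)}) \<le> (1 - \<delta>) * m}
           \<le> exp (- (\<delta>\<^sup>2 * m / 2))"
proof -
  define W where "W v y = exp (- \<delta> * indicator {y. Q v y} y)" for v y
  define \<pi> where "\<pi> v = measure_pmf.prob (P v) {y. Q v y}" for v
  have W: "measure_pmf.expectation (P v) (W v) = 1 - \<pi> v * (1 - exp (- \<delta>))" for v
  proof -
    have "W v = (\<lambda>y. 1 - (1 - exp (- \<delta>)) * indicator {y. Q v y} y)"
      by (auto simp: W_def indicator_def)
    then have "measure_pmf.expectation (P v) (W v)
        = measure_pmf.expectation (P v) (\<lambda>y. 1 - (1 - exp (- \<delta>)) * indicator {y. Q v y} y)"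
      by simp
    also have "\<dots> = 1 - (1 - exp (- \<delta>)) * \<pi> v"
    proof (subst Bochner_Integration.integral_diff)
      have "integrable (measure_pmf (P v)) (indicator {y. Q v y} :: 'b \<Rightarrow> real)"
        by (rule measure_pmf.integrable_const_bound[where B=1]) auto
      then show "integrable (measure_pmf (P v)) (\<lambda>y. (1 - exp (- \<delta>)) * indicator {y. Q v y} y)"
        by (rule integrable_mult_right)
    qed (simp_all only: integral_mult_right_zero integral_indicator \<pi>_def, simp_all)
    finally show ?thesis by (simp add: mult.commute)
  qed
  have Wexp: "(\<Prod>v\<in>V. W v (f v)) = exp (- \<delta> * real (card {v \<in> V. Q v (f v)}))" for f
  proof -
    have "(\<Sum>v\<in>V. - \<delta> * indicator {y. Q v y} (f v)) = - \<delta> * (\<Sum>v\<in>V. indicator {y. Q v y} (f v))"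
      by (rule sum_distrib_left[symmetric])
    also have "(\<Sum>v\<in>V. indicator {y. Q v y} (f v)) = (\<Sum>v\<in>V. if Q v (f v) then 1 else 0::real)"
      by (intro sum.cong) (auto simp: indicator_def)
    also have "\<dots> = real (card {v \<in> V. Q v (f v)})"
      using assms(1) by (simp add: sum.If_cases Int_def)
    finally show ?thesis by (simp add: W_def exp_sum[OF assms(1), symmetric])
  qed
  have le1: "W v y \<le> 1" "W v y > 0" for v y
    using assms(2) by (auto simp: W_def indicator_def)
  have "measure_pmf.expectation (Pi_pmf V d P) (\<lambda>f. \<Prod>v\<in>V. W v (f v))
      = (\<Prod>v\<in>V. measure_pmf.expectation (P v) (W v))"
    by (rule expectation_prod_Pi_pmf[OF assms(1)])
       (auto intro!: measure_pmf.integrable_const_bound[where B=1] simp: le1 less_imp_le)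
  also have "\<dots> \<le> (\<Prod>v\<in>V. exp (- \<pi> v * (1 - exp (- \<delta>))))"
  proof (intro prod_mono conjI)
    fix v
    show "measure_pmf.expectation (P v) (W v) \<le> exp (- \<pi> v * (1 - exp (- \<delta>)))"
      unfolding W using exp_ge_add_one_self[of "- \<pi> v * (1 - exp (- \<delta>))"] by simp
    show "0 \<le> measure_pmf.expectation (P v) (W v)"
      by (intro integral_nonneg_AE) (auto simp: le1 less_imp_le)
  qed
  also have "\<dots> = exp (- (\<Sum>v\<in>V. \<pi> v) * (1 - exp (- \<delta>)))"
    by (simp add: exp_sum[OF assms(1), symmetric] sum_distrib_right sum_negf)
  also have "\<dots> \<le> exp (- m * (1 - exp (- \<delta>)))"
    using m assms(2) by (auto simp: \<pi>_def intro!: mult_right_mono)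
  finally have E: "measure_pmf.expectation (Pi_pmf V d P) (\<lambda>f. \<Prod>v\<in>V. W v (f v))
      \<le> exp (- m * (1 - exp (- \<delta>)))" .
  have int: "integrable (measure_pmf (Pi_pmf V d P)) (\<lambda>f. \<Prod>v\<in>V. W v (f v))"
    by (rule measure_pmf.integrable_const_bound[where B=1])
       (auto simp: le1 less_imp_le abs_prod intro!: prod_le_1)
  let ?a = "exp (- \<delta> * ((1 - \<delta>) * m))"
  have "measure_pmf.prob (Pi_pmf V d P) {f. real (card {v \<in> V. Q v (f v)}) \<le> (1 - \<delta>) * m}
      \<le> measure_pmf.prob (Pi_pmf V d P) {f \<in> space (measure_pmf (Pi_pmf V d P)). ?a \<le> (\<Prod>v\<in>V. W v (f v))}"
  proof (rule measure_pmf.finite_measure_mono)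
    show "{f. real (card {v \<in> V. Q v (f v)}) \<le> (1 - \<delta>) * m}
        \<subseteq> {f \<in> space (measure_pmf (Pi_pmf V d P)). ?a \<le> (\<Prod>v\<in>V. W v (f v))}"
      using assms(2) unfolding Wexp by (auto intro!: mult_left_mono)
  qed simp
  also have "\<dots> \<le> measure_pmf.expectation (Pi_pmf V d P) (\<lambda>f. \<Prod>v\<in>V. W v (f v)) / ?a"
    by (rule integral_Markov_inequality_measure[OF int])
       (auto intro!: prod_nonneg simp: le1 less_imp_le)
  also have "\<dots> \<le> exp (- m * (1 - exp (- \<delta>))) / ?a"
    by (intro divide_right_mono E) simp
  also have "\<dots> = exp (- m * (1 - exp (- \<delta>)) + \<delta> * ((1 - \<delta>) * m))"
    by (simp flip: exp_diff)
  also have "\<dots> \<le> exp (- (\<delta>\<^sup>2 * m / 2))"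
  proof -
    have "m * (exp (- \<delta>) - 1 + \<delta> - \<delta>\<^sup>2 / 2) \<le> 0"
      using exp_minus_le_quadratic[OF assms(2)] assms(3) by (intro mult_nonneg_nonpos) auto
    then show ?thesis by (simp add: algebra_simps power2_eq_square)
  qed
  finally show ?thesis .
qed

lemma power_diff_le_mult:
  fixes x y :: real
  assumes "0 \<le> y" "y \<le> x"
  shows "x ^ Suc n - y ^ Suc n \<le> (x - y) * (real (Suc n) * x ^ n)"
proof -
  have "x ^ Suc n - y ^ Suc n = (x - y) * (\<Sum>p<Suc n. x ^ p * y ^ (n - p))"
    by (subst power_diff_sumr2) (simp add: mult.commute)
  also have "(\<Sum>p<Suc n. x ^ p * y ^ (n - p)) \<le> (\<Sum>p<Suc n. x ^ n)"
  proof (rule sum_mono)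
    fix p assume "p \<in> {..<Suc n}"
    then have "x ^ p * y ^ (n - p) \<le> x ^ p * x ^ (n - p)"
      using assms by (intro mult_left_mono power_mono) auto
    also have "\<dots> = x ^ n" using \<open>p \<in> _\<close> by (simp flip: power_add)
    finally show "x ^ p * y ^ (n - p) \<le> x ^ n" .
  qed
  finally show ?thesis using assms by (simp add: mult_left_mono)
qed

text \<open>Degree \<open>Suc r\<close> is truncated at a point larger by \<open>b\<close> than
  degree \<open>r\<close>. This absorbs the increment \<open>p \<le> b\<close>: the slope of the
  power at its right end \<open>x\<close> is already bounded by the term of degree \<open>r\<close>
  at the old \<open>l\<close>, and no error of second order in \<open>p\<close> remains.\<close>

lemma truncated_power_step:
  fixes l b p :: real
  assumes "0 \<le> p" "p \<le> b"
  shows "max 0 (l + p - real (Suc r) * b) ^ Suc r / fact (Suc r)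
      \<le> max 0 (l - real (Suc r) * b) ^ Suc r / fact (Suc r) + p * (max 0 (l - real r * b) ^ r / fact r)"
proof -
  define x where "x = max 0 (l + p - real (Suc r) * b)"
  define y where "y = max 0 (l - real (Suc r) * b)"
  have xy: "0 \<le> y" "y \<le> x" "x - y \<le> p" using assms by (auto simp: x_def y_def)
  have x: "x \<le> max 0 (l - real r * b)" using assms by (auto simp: x_def algebra_simps)
  have "x ^ Suc r - y ^ Suc r \<le> (x - y) * (real (Suc r) * x ^ r)"
    by (rule power_diff_le_mult[OF xy(1,2)])
  also have "\<dots> \<le> p * (real (Suc r) * max 0 (l - real r * b) ^ r)"
    using xy x assms by (intro mult_mono mult_left_mono power_mono) auto
  finally have "x ^ Suc r \<le> y ^ Suc r + real (Suc r) * (p * max 0 (l - real r * b) ^ r)"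
    by (simp add: mult.left_commute)
  then have "x ^ Suc r / fact (Suc r)
      \<le> (y ^ Suc r + real (Suc r) * (p * max 0 (l - real r * b) ^ r)) / fact (Suc r)"
    by (rule divide_right_mono) simp
  also have "\<dots> = y ^ Suc r / fact (Suc r) + p * (max 0 (l - real r * b) ^ r / fact r)"
    unfolding fact_Suc by (simp add: add_divide_distrib del: of_nat_Suc power_Suc)
  finally show ?thesis by (simp only: x_def y_def)
qed

lemma prob_bind_pmf:
  "measure_pmf.prob (bind_pmf p f) X = measure_pmf.expectation p (\<lambda>x. measure_pmf.prob (f x) X)"
proof -
  have "ennreal (measure_pmf.prob (bind_pmf p f) X) = (\<integral>\<^sup>+x. ennreal (measure_pmf.prob (f x) X) \<partial>measure_pmf p)"
    by (simp flip: measure_pmf.emeasure_eq_measure)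
  also have "\<dots> = ennreal (measure_pmf.expectation p (\<lambda>x. measure_pmf.prob (f x) X))"
    by (intro nn_integral_eq_integral measure_pmf.integrable_const_bound[where B=1]) auto
  finally show ?thesis
    by (subst (asm) ennreal_inj) (auto intro!: integral_nonneg_AE)
qed

lemma prob_pair_pmf_le:
  assumes "\<And>y. y \<in> set_pmf B \<Longrightarrow> measure_pmf.prob A {x. (x, y) \<in> X} \<le> b"
  shows "measure_pmf.prob (pair_pmf A B) X \<le> b"
proof -
  have "pair_pmf A B = bind_pmf B (\<lambda>y. map_pmf (\<lambda>x. (x, y)) A)"
    unfolding pair_pmf_def map_pmf_def by (rule bind_commute_pmf)
  then have "measure_pmf.prob (pair_pmf A B) X = measure_pmf.expectation B (\<lambda>y. measure_pmf.prob A {x. (x, y) \<in> X})"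
    by (simp add: prob_bind_pmf vimage_def)
  also have "\<dots> \<le> measure_pmf.expectation B (\<lambda>y. b)"
  proof (rule integral_mono_AE)
    show "integrable (measure_pmf B) (\<lambda>y. measure_pmf.prob A {x. (x, y) \<in> X})"
      by (rule measure_pmf.integrable_const_bound[where B = 1]) auto
  qed (use assms in \<open>auto simp: AE_measure_pmf_iff\<close>)
  finally show ?thesis by simp
qed

text \<open>
  The \<open>r\<close>-th elementary symmetric polynomial of numbers in \<open>[0, b]\<close> with sum \<open>l\<close> is at least
  \<open>(l - r b)\<^sub>+\<^sup>r / r!\<close>, by induction through \<open>truncated_power_step\<close>; the factor \<open>1 - l\<close> accounts for the remaining variables being \<open>0\<close>.
\<close>

lemma prob_card_eq_lower:
  fixes p :: "'a \<Rightarrow> real"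
  assumes "finite X" and "\<And>x. x \<in> X \<Longrightarrow> 0 \<le> p x \<and> p x \<le> b" and "sum p X \<le> 1" "0 \<le> b" "b \<le> 1"
  shows "measure_pmf.prob (Pi_pmf X False (\<lambda>x. bernoulli_pmf (p x))) {f. card {x \<in> X. f x} = r}
           \<ge> (1 - sum p X) * (max 0 (sum p X - real r * b) ^ r / fact r)"
  using assms
proof (induction X arbitrary: r rule: finite_induct)
  case empty
  then show ?case
    by (cases r) (auto simp: measure_return_pmf max_def)
next
  case (insert x X)
  let ?P = "Pi_pmf X False (\<lambda>x. bernoulli_pmf (p x))"
  let ?b = "\<lambda>r. measure_pmf.prob ?P {f. card {x \<in> X. f x} = r}"
  let ?l = "sum p X"
  let ?E = "\<lambda>l r. max 0 (l - real r * b) ^ r / fact r"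
  have px: "0 \<le> p x" "p x \<le> b" and l0: "0 \<le> ?l" and l: "?l + p x \<le> 1"
    using insert.prems insert.hyps by (auto intro!: sum_nonneg simp: add.commute)
  have px1: "p x \<le> 1" using px(2) insert.prems(4) by simp
  have IH: "(1 - ?l) * ?E ?l r \<le> ?b r" for r
    using insert.IH insert.prems px l by auto
  have card: "card {y \<in> insert x X. (f(x := z)) y} = of_bool z + card {y \<in> X. f y}" for f z
  proof -
    have "{y \<in> insert x X. (f(x := z)) y} = (if z then insert x {y \<in> X. f y} else {y \<in> X. f y})"
      using insert.hyps by auto
    then show ?thesis using insert.hyps by auto
  qed
  have "measure_pmf.prob (Pi_pmf (insert x X) False (\<lambda>x. bernoulli_pmf (p x))) {f. card {y \<in> insert x X. f y} = r}
      = measure_pmf.expectation (bernoulli_pmf (p x))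
          (\<lambda>z. measure_pmf.prob ?P {f. of_bool z + card {y \<in> X. f y} = r})"
    using insert.hyps
    by (subst Pi_pmf_insert')
       (simp_all only: prob_bind_pmf map_pmf_def[symmetric] measure_map_pmf vimage_def mem_Collect_eq card not_False_eq_True)
  also have "\<dots> = p x * measure_pmf.prob ?P {f. Suc (card {y \<in> X. f y}) = r} + (1 - p x) * ?b r"
    using px px1 by simp
  finally have eq: "measure_pmf.prob (Pi_pmf (insert x X) False (\<lambda>x. bernoulli_pmf (p x))) {f. card {y \<in> insert x X. f y} = r}
      = p x * measure_pmf.prob ?P {f. Suc (card {y \<in> X. f y}) = r} + (1 - p x) * ?b r" .
  have S: "sum p (insert x X) = ?l + p x" using insert.hyps by simp
  \<comment> \<open>The new variable is 0 with probability \<open>1 - p x\<close>; its product with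
    \<open>1 - ?l\<close> is relaxed to 1 minus the new sum.\<close>
  have pq: "1 - (?l + p x) \<le> (1 - p x) * (1 - ?l)" using px l0 by (simp add: algebra_simps)
  show ?case
  proof (cases r)
    case 0
    have "1 - (?l + p x) \<le> (1 - p x) * (1 - ?l)" by (rule pq)
    also have "\<dots> \<le> (1 - p x) * ?b 0"
      using IH[of 0] px1 by (intro mult_left_mono) auto
    finally show ?thesis unfolding eq S unfolding 0 by simp
  next
    case (Suc r')
    have "(1 - (?l + p x)) * ?E (?l + p x) (Suc r')
        \<le> (1 - (?l + p x)) * (?E ?l (Suc r') + p x * ?E ?l r')"
      using l by (intro mult_left_mono truncated_power_step px) auto
    also have "\<dots> \<le> (1 - p x) * ((1 - ?l) * ?E ?l (Suc r')) + p x * ((1 - ?l) * ?E ?l r')"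
    proof -
      have 1: "(1 - (?l + p x)) * ?E ?l (Suc r') \<le> ((1 - p x) * (1 - ?l)) * ?E ?l (Suc r')"
        by (rule mult_right_mono[OF pq]) auto
      have 2: "(1 - (?l + p x)) * (p x * ?E ?l r') \<le> (1 - ?l) * (p x * ?E ?l r')"
        using px by (intro mult_right_mono) auto
      show ?thesis using 1 2 by (simp only: distrib_left mult.assoc mult.left_commute)
    qed
    also have "\<dots> \<le> (1 - p x) * ?b (Suc r') + p x * ?b r'"
      using px px1 by (intro add_mono mult_left_mono IH) auto
    finally show ?thesis unfolding eq S unfolding Suc by simp
  qed
qed

section \<open>Exploration of the graph\<close>

lemma adjacent_sym: "adjacent h u v \<longleftrightarrow> adjacent h v u"
  by (auto simp: adjacent_def)

lemma not_adjacent_self [simp]: "\<not> adjacent h v v"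
  by (auto simp: adjacent_def)

lemma percolation_rounds_mono:
  assumes "s \<le> t"
  shows "(percolation_step r n h ^^ s) Z \<subseteq> (percolation_step r n h ^^ t) Z"
  using assms by (rule lift_Suc_mono_le[rotated]) (auto simp: percolation_step_def)

lemma percolation_rounds_subset:
  "Z \<subseteq> {..<n} \<Longrightarrow> (percolation_step r n h ^^ t) Z \<subseteq> {..<n}"
  by (induction t) (auto simp: percolation_step_def)

lemma final_active_bounds:
  assumes "Z \<subseteq> {..<n}"
  shows "Z \<subseteq> final_active r n h Z" "final_active r n h Z \<subseteq> {..<n}"
proof -
  have "Z = (percolation_step r n h ^^ 0) Z" by simp
  then show "Z \<subseteq> final_active r n h Z" unfolding final_active_def by blast
  show "final_active r n h Z \<subseteq> {..<n}"
    unfolding final_active_def using percolation_rounds_subset[OF assms] by blast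
qed

lemma final_active_closed:
  assumes "Z \<subseteq> {..<n}" "v < n" "r \<le> card {u \<in> final_active r n h Z. adjacent h u v}"
  shows "v \<in> final_active r n h Z"
proof -
  let ?R = "\<lambda>t. (percolation_step r n h ^^ t) Z"
  have fin: "finite (final_active r n h Z)"
    by (rule finite_subset[OF final_active_bounds(2)[OF assms(1)]]) simp
  have "\<forall>u\<in>final_active r n h Z. \<exists>t. u \<in> ?R t" by (auto simp: final_active_def)
  then obtain T where T: "\<And>u. u \<in> final_active r n h Z \<Longrightarrow> u \<in> ?R (T u)" by metis
  \<comment> \<open>Any common upper bound of the entry times works; a sum, unlike
    \<open>Max\<close>, needs no case for the empty set.\<close>
  define t where "t = (\<Sum>u\<in>final_active r n h Z. T u)"
  have "T u \<le> t" if "u \<in> final_active r n h Z" for u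
    unfolding t_def by (rule member_le_sum[OF that]) (use fin in auto)
  then have "final_active r n h Z \<subseteq> ?R t" using T percolation_rounds_mono by blast
  then have "final_active r n h Z = ?R t" by (auto simp: final_active_def)
  then have "v \<in> ?R (Suc t)" using assms by (simp add: percolation_step_def)
  then show ?thesis unfolding final_active_def by blast
qed

lemma final_active_least:
  assumes "Z \<subseteq> X" "finite X" "\<And>v. \<lbrakk>v < n; r \<le> card {u \<in> X. adjacent h u v}\<rbrakk> \<Longrightarrow> v \<in> X"
  shows "final_active r n h Z \<subseteq> X"
proof -
  have "(percolation_step r n h ^^ t) Z \<subseteq> X" for t
  proof (induction t)
    case (Suc t)
    show ?case
    proof
      fix v assume v: "v \<in> (percolation_step r n h ^^ Suc t) Z"
      show "v \<in> X"
      proof (cases "v \<in> (percolation_step r n h ^^ t) Z")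
        case False
        then have "v < n" "r \<le> card {u \<in> (percolation_step r n h ^^ t) Z. adjacent h u v}"
          using v by (auto simp: percolation_step_def)
        moreover have "card {u \<in> (percolation_step r n h ^^ t) Z. adjacent h u v} \<le> card {u \<in> X. adjacent h u v}"
          using Suc assms(2) by (intro card_mono) auto
        ultimately show ?thesis using assms(3) by simp
      qed (use Suc in auto)
    qed
  qed (use assms in simp)
  then show ?thesis by (auto simp: final_active_def)
qed

section \<open>Cells indexed by community and order of use\<close>

definition key :: "(nat \<Rightarrow> 'a) \<Rightarrow> nat \<Rightarrow> 'a \<times> nat" where
  "key d m = (d m, card {l. l < m \<and> d l = d m})"

text \<open>Within each label the ranks are handed out without gaps, so the keys of an initial
  segment depend only on how often each label occurred. This lets \<open>marks\<close> depend on the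
  numbers of used nodes and not on their order.\<close>

lemma key_image: "key d ` {..<m} = {(j, s). s < card {l. l < m \<and> d l = j}}"
proof (induction m)
  case (Suc m)
  have "{l. l < Suc m \<and> d l = j} = (if d m = j then insert m {l. l < m \<and> d l = j} else {l. l < m \<and> d l = j})" for j
    by (auto simp: less_Suc_eq)
  then have "card {l. l < Suc m \<and> d l = j} = (if d m = j then Suc (card {l. l < m \<and> d l = j}) else card {l. l < m \<and> d l = j})" for j
    by simp
  then show ?case
    using Suc by (auto simp: lessThan_Suc key_def less_Suc_eq split: if_splits)
qed simp

lemma key_neq:
  assumes "l < m"
  shows "key d l \<noteq> key d m"
proof
  assume eq: "key d l = key d m"
  then have "{i. i < l \<and> d i = d l} \<subset> {i. i < m \<and> d i = d m}"
    using assms by (auto simp: key_def)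
  then have "card {i. i < l \<and> d i = d l} < card {i. i < m \<and> d i = d m}"
    by (intro psubset_card_mono) auto
  then show False using eq by (simp add: key_def)
qed

lemma inj_key: "inj (key d)"
  by (rule injI) (metis key_neq linorder_neqE_nat)

text \<open>
  In the arrays below, the cell \<open>(j, s)\<close> of the node \<open>v\<close> stands for the edge between \<open>v\<close> and the
  \<open>s\<close>-th node of community \<open>j\<close> that is used, counted from \<open>0\<close>. If \<open>v\<close> has been used
  before, the cell is redundant and does not correspond to an edge.
\<close>

definition mark_pmf :: "nat \<Rightarrow> nat \<Rightarrow> (nat \<Rightarrow> nat \<Rightarrow> real) \<Rightarrow> nat \<Rightarrow> (nat \<times> nat \<Rightarrow> bool) pmf" where
  "mark_pmf n k q i = Pi_pmf ({1..k} \<times> {..<n}) False (\<lambda>(j, s). bernoulli_pmf (q i j))"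

definition array_pmf :: "nat \<Rightarrow> nat \<Rightarrow> (nat \<Rightarrow> nat) \<Rightarrow> (nat \<Rightarrow> nat \<Rightarrow> real) \<Rightarrow> (nat \<Rightarrow> nat \<times> nat \<Rightarrow> bool) pmf" where
  "array_pmf n k c q = Pi_pmf {..<n} (\<lambda>_. False) (\<lambda>v. mark_pmf n k q (c v))"

definition marks :: "nat \<Rightarrow> (nat \<Rightarrow> nat) \<Rightarrow> (nat \<times> nat \<Rightarrow> bool) \<Rightarrow> nat" where
  "marks k t g = card {x \<in> Sigma {1..k} (\<lambda>j. {..<t j}). g x}"

definition activated :: "nat \<Rightarrow> nat \<Rightarrow> (nat \<Rightarrow> nat) \<Rightarrow> nat \<Rightarrow> nat set \<Rightarrow> (nat \<Rightarrow> nat) \<Rightarrow> (nat \<Rightarrow> nat \<times> nat \<Rightarrow> bool) \<Rightarrow> nat \<Rightarrow> nat set" where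
  "activated n k c r Z t f i = {v \<in> community n c i. v \<in> Z \<or> r \<le> marks k t (f v)}"

section \<open>The exploration of a fixed graph\<close>

locale exploration =
  fixes n k r :: nat and c :: "nat \<Rightarrow> nat" and q :: "nat \<Rightarrow> nat \<Rightarrow> real" and Z :: "nat set"
  assumes c: "\<And>v. v < n \<Longrightarrow> c v \<in> {1..k}"
    and q_sym: "\<And>i j. \<lbrakk>i \<in> {1..k}; j \<in> {1..k}\<rbrakk> \<Longrightarrow> q i j = q j i"
    and Z: "Z \<subseteq> {..<n}"
begin

definition frontier :: "(nat \<times> nat \<Rightarrow> bool) \<Rightarrow> nat set \<Rightarrow> nat set" where
  "frontier h X = (Z \<union> {v. v < n \<and> r \<le> card {u \<in> X. adjacent h u v}}) - X"

text \<open>When the frontier is empty, the exploration goes on with inactive nodes. Every node is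
  thus used exactly once and every pair is eventually read, so that an array determines the whole
  graph and not only the part that the percolation sees.\<close>

definition next_node :: "(nat \<times> nat \<Rightarrow> bool) \<Rightarrow> nat set \<Rightarrow> nat" where
  "next_node h X = (if frontier h X \<noteq> {} then Min (frontier h X) else Min ({..<n} - X))"

primrec used :: "(nat \<times> nat \<Rightarrow> bool) \<Rightarrow> nat \<Rightarrow> nat set" where
  "used h 0 = {}"
| "used h (Suc m) = insert (next_node h (used h m)) (used h m)"

definition node :: "(nat \<times> nat \<Rightarrow> bool) \<Rightarrow> nat \<Rightarrow> nat" where
  "node h m = next_node h (used h m)"

abbreviation U :: "(nat \<times> nat \<Rightarrow> bool) \<Rightarrow> nat set" where
  "U h \<equiv> final_active r n h Z"

lemma frontier_subset: "frontier h X \<subseteq> {..<n} - X"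
  using Z by (auto simp: frontier_def)

lemma next_node_in:
  assumes "{..<n} - X \<noteq> {}"
  shows "next_node h X \<in> {..<n} - X"
proof (cases "frontier h X = {}")
  case True
  then show ?thesis using Min_in[of "{..<n} - X"] assms by (simp add: next_node_def)
next
  case False
  have "finite (frontier h X)" using frontier_subset finite_subset by blast
  then have "next_node h X \<in> frontier h X" using False by (simp add: next_node_def)
  then show ?thesis using frontier_subset by blast
qed

lemma used_image: "used h m = node h ` {..<m}"
  by (induction m) (simp_all add: lessThan_Suc node_def)

lemma used_bounds:
  assumes "m \<le> n"
  shows "used h m \<subseteq> {..<n}" "card (used h m) = m"
proof -
  have "used h m \<subseteq> {..<n} \<and> card (used h m) = m"
    using assms
  proof (induction m)
    case (Suc m)
    then have IH: "used h m \<subseteq> {..<n}" "card (used h m) = m" by auto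
    have "{..<n} - used h m \<noteq> {}"
    proof
      assume "{..<n} - used h m = {}"
      then have "{..<n} \<subseteq> used h m" by auto
      then have "card {..<n} \<le> card (used h m)"
        by (intro card_mono) (auto simp: used_image)
      then show False using IH Suc.prems by simp
    qed
    from next_node_in[OF this, of h] IH show ?case
      using finite_subset[OF IH(1)] by auto
  qed simp
  then show "used h m \<subseteq> {..<n}" "card (used h m) = m" by auto
qed

declare used.simps(2) [simp del]

lemma node_bij: "bij_betw (node h) {..<n} {..<n}"
proof -
  have *: "used h n = {..<n}"
    using used_bounds[of n h] by (intro card_subset_eq) auto
  then have "inj_on (node h) {..<n}"
    using used_image[of h n] by (intro eq_card_imp_inj_on) auto
  then show ?thesis using used_image[of h n] * by (simp add: bij_betw_def)
qed

lemma node_less: "m < n \<Longrightarrow> node h m < n"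
  using node_bij[of h] by (auto simp: bij_betw_def)

lemma node_in_used_iff:
  assumes "l < n" "m \<le> n"
  shows "node h l \<in> used h m \<longleftrightarrow> l < m"
proof
  assume "node h l \<in> used h m"
  then obtain l' where "l' < m" "node h l = node h l'" by (auto simp: used_image)
  then have "l = l'" using node_bij[of h] assms by (auto simp: bij_betw_def dest!: inj_onD)
  then show "l < m" using \<open>l' < m\<close> by simp
qed (auto simp: used_image)

text \<open>As long as \<open>used h m\<close> does not cover the final set, the frontier is
  nonempty by \<open>final_active_least\<close>, and a frontier node of a subset of the final set is
  active. Active nodes are therefore used before all others, and the final set is itself a stage of
  the exploration.\<close>

lemma used_comparable: "used h m \<subseteq> U h \<or> U h \<subseteq> used h m"
proof (induction m)
  case (Suc m)
  have fU: "finite (U h)" using final_active_bounds(2)[OF Z] finite_subset by blast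
  show ?case
  proof (cases "U h \<subseteq> used h m")
    case False
    then have sub: "used h m \<subseteq> U h" using Suc by blast
    then have fin: "finite (used h m)" using fU finite_subset by blast
    have "frontier h (used h m) \<noteq> {}"
    proof
      assume "frontier h (used h m) = {}"
      then have "U h \<subseteq> used h m"
        by (intro final_active_least) (auto simp: frontier_def fin)
      then show False using False by simp
    qed
    moreover have "finite (frontier h (used h m))" using frontier_subset finite_subset by blast
    ultimately have "next_node h (used h m) \<in> frontier h (used h m)" by (simp add: next_node_def)
    then consider "next_node h (used h m) \<in> Z"
      | "next_node h (used h m) < n" "r \<le> card {u \<in> used h m. adjacent h u (next_node h (used h m))}"
      by (auto simp: frontier_def)
    then have "next_node h (used h m) \<in> U h"
    proof cases
      case 1
      then show ?thesis using final_active_bounds(1)[OF Z] by blast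
    next
      case 2
      have "card {u \<in> used h m. adjacent h u (next_node h (used h m))}
          \<le> card {u \<in> U h. adjacent h u (next_node h (used h m))}"
        using sub fU by (intro card_mono) auto
      then show ?thesis using 2 by (intro final_active_closed[OF Z]) auto
    qed
    then show ?thesis using sub by (simp add: used.simps)
  qed (auto simp: used.simps)
qed simp

lemma card_U_le: "card (U h) \<le> n"
  using card_mono[OF _ final_active_bounds(2)[OF Z]] by simp

lemma used_card_U: "used h (card (U h)) = U h"
proof -
  have fU: "finite (U h)" using final_active_bounds(2)[OF Z] finite_subset by blast
  have f: "finite (used h (card (U h)))" by (simp add: used_image)
  have c: "card (used h (card (U h))) = card (U h)" by (rule used_bounds[OF card_U_le])
  from used_comparable[of h "card (U h)"] show ?thesis
    using card_subset_eq[OF fU _ c] card_subset_eq[OF f _ c[symmetric]] by blast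
qed

text \<open>
  The array \<open>f\<close> agrees with the edges of \<open>h\<close> in the order in which the exploration reveals them: the edge
  between the node used at time \<open>m\<close> and a node not yet used is read from a fresh cell.
\<close>

definition consistent :: "(nat \<Rightarrow> nat \<times> nat \<Rightarrow> bool) \<Rightarrow> (nat \<times> nat \<Rightarrow> bool) \<Rightarrow> bool" where
  "consistent f h \<longleftrightarrow> (\<forall>v<n. \<forall>m<n. v \<notin> used h (Suc m) \<longrightarrow>
     f v (key (\<lambda>l. c (node h l)) m) = adjacent h (node h m) v)"

text \<open>By \<open>key_image\<close> the cells of the first \<open>m\<close> times fill exactly
  the block that \<open>marks\<close> inspects, and for a node not yet used each of these cells is
  fresh.\<close>

lemma marks_consistent:
  assumes "consistent f h" "m \<le> n" "v < n" "v \<notin> used h m"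
  shows "marks k (\<lambda>j. card (used h m \<inter> community n c j)) (f v) = card {u \<in> used h m. adjacent h u v}"
proof -
  let ?d = "\<lambda>l. c (node h l)"
  have inj: "inj_on (node h) {..<m}"
    using node_bij[of h] assms(2) by (auto simp: bij_betw_def intro: inj_on_subset)
  have nless: "node h l < n" if "l < m" for l using node_less that assms(2) by auto
  have card: "card (used h m \<inter> community n c j) = card {l. l < m \<and> ?d l = j}" for j
  proof -
    have "used h m \<inter> community n c j = node h ` {l. l < m \<and> ?d l = j}"
      using nless by (auto simp: used_image community_def)
    then show ?thesis using inj by (simp add: card_image inj_on_def)
  qed
  have fv: "f v (key ?d l) = adjacent h (node h l) v" if "l < m" for l
  proof -
    have "used h (Suc l) \<subseteq> used h m" unfolding used_image using that by auto
    then have "v \<notin> used h (Suc l)" "l < n" using assms(2,4) that by auto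
    then show ?thesis using assms(1,3) unfolding consistent_def by blast
  qed
  have "Sigma {1..k} (\<lambda>j. {..<card (used h m \<inter> community n c j)}) = key ?d ` {..<m}"
    unfolding key_image card
  proof safe
    fix j s assume "s < card {l. l < m \<and> ?d l = j}"
    then have "{l. l < m \<and> ?d l = j} \<noteq> {}" by (metis card.empty not_less_zero)
    then show "j \<in> {1..k}" using c nless by auto
  qed
  then have "marks k (\<lambda>j. card (used h m \<inter> community n c j)) (f v) = card {x \<in> key ?d ` {..<m}. f v x}"
    by (simp add: marks_def)
  also have "{x \<in> key ?d ` {..<m}. f v x} = key ?d ` {l \<in> {..<m}. adjacent h (node h l) v}"
    using fv by auto
  also have "card \<dots> = card {l \<in> {..<m}. adjacent h (node h l) v}"
    by (intro card_image inj_on_subset[OF inj_key]) auto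
  also have "\<dots> = card (node h ` {l \<in> {..<m}. adjacent h (node h l) v})"
    by (intro card_image[symmetric] inj_on_subset[OF inj]) auto
  also have "node h ` {l \<in> {..<m}. adjacent h (node h l) v} = {u \<in> used h m. adjacent h u v}"
    by (auto simp: used_image)
  finally show ?thesis .
qed

lemma activated_consistent:
  assumes "consistent f h"
  shows "activated n k c r Z (\<lambda>j. card (U h \<inter> community n c j)) f i \<subseteq> U h \<inter> community n c i"
proof -
  have "v \<in> U h" if v: "v < n" "r \<le> marks k (\<lambda>j. card (U h \<inter> community n c j)) (f v)" for v
  proof (rule ccontr)
    assume "v \<notin> U h"
    then have "marks k (\<lambda>j. card (U h \<inter> community n c j)) (f v) = card {u \<in> U h. adjacent h u v}"
      using marks_consistent[OF assms card_U_le v(1), of h] by (simp add: used_card_U)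
    then show False using final_active_closed[OF Z v(1)] v(2) \<open>v \<notin> U h\<close> by simp
  qed
  then show ?thesis using final_active_bounds(1)[OF Z] by (auto simp: activated_def community_def)
qed

text \<open>The choice of the next node looks only at edges incident with used nodes, which agree by
  induction. Both graphs then read the same fresh cells, and the edges from the new node back to
  used nodes are known by symmetry.\<close>

lemma consistent_unique_aux:
  assumes f: "consistent f h" "consistent f h'" and "m \<le> n"
  shows "(\<forall>l<m. node h l = node h' l) \<and> (\<forall>l<m. \<forall>v<n. adjacent h (node h l) v = adjacent h' (node h l) v)"
  using assms(3)
proof (induction m)
  case (Suc m)
  then have IH: "\<And>l. l < m \<Longrightarrow> node h l = node h' l"
    "\<And>l v. \<lbrakk>l < m; v < n\<rbrakk> \<Longrightarrow> adjacent h (node h l) v = adjacent h' (node h l) v" by auto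
  have us: "used h m = used h' m" using IH(1) by (auto simp: used_image)
  have "{u \<in> used h m. adjacent h u v} = {u \<in> used h m. adjacent h' u v}" if "v < n" for v
    using IH(2) that by (auto simp: used_image)
  then have fr: "frontier h (used h m) = frontier h' (used h m)"
    by (auto simp: frontier_def)
  have nd: "node h m = node h' m" unfolding node_def next_node_def us[symmetric] fr ..
  have nd': "node h l = node h' l" if "l < Suc m" for l using IH(1) nd that by (auto simp: less_Suc_eq)
  then have us': "used h (Suc m) = used h' (Suc m)" unfolding used_image by (intro image_cong) auto
  have key: "key (\<lambda>l. c (node h l)) m = key (\<lambda>l. c (node h' l)) m"
    unfolding key_def using nd' by (auto intro!: arg_cong[where f=card])
  have "adjacent h (node h m) v = adjacent h' (node h m) v" if v: "v < n" for v
  proof (cases "v \<in> used h (Suc m)")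
    case False
    then show ?thesis using f v Suc.prems key us' nd unfolding consistent_def
      by (metis Suc_le_lessD)
  next
    case True
    then obtain l where l: "l < Suc m" "v = node h l" by (auto simp: used_image)
    show ?thesis
    proof (cases "l = m")
      case False
      then have "l < m" using l by simp
      moreover have "node h m < n" using node_less Suc.prems by simp
      ultimately show ?thesis using IH(2) l adjacent_sym by metis
    qed (use l in simp)
  qed
  then show ?case using IH nd by (auto simp: less_Suc_eq)
qed simp

section \<open>Comparison of the laws of the graph and of the array\<close>

abbreviation pairs :: "(nat \<times> nat) set" where
  "pairs \<equiv> {(u, v). u < v \<and> v < n}"

lemma finite_pairs: "finite pairs"
  by (rule finite_subset[of _ "{..<n} \<times> {..<n}"]) auto

lemma consistent_unique:
  assumes "consistent f h" "consistent f h'"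
    and "h \<in> PiE_dflt pairs False (\<lambda>_. UNIV)" "h' \<in> PiE_dflt pairs False (\<lambda>_. UNIV)"
  shows "h = h'"
proof
  fix x :: "nat \<times> nat"
  obtain u v where x: "x = (u, v)" by fastforce
  show "h x = h' x"
  proof (cases "u < v \<and> v < n")
    case True
    then have "u \<in> node h ` {..<n}" using node_bij[of h] by (simp add: bij_betw_def)
    then obtain l where "l < n" "node h l = u" by auto
    then have "adjacent h u v = adjacent h' u v"
      using consistent_unique_aux[OF assms(1,2) order.refl] True by blast
    then show ?thesis using True x by (simp add: adjacent_def)
  \<comment> \<open>Off \<open>pairs\<close> the array says nothing; both functions have the default
    value \<open>False\<close> there.\<close>
  qed (use assms(3,4) x in \<open>auto simp: PiE_dflt_def\<close>)
qed

text \<open>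
  By uniqueness, the events \<open>consistent f h\<close> for different graphs \<open>h\<close> are disjoint; as they have
  the probabilities of the graphs, no process driven by the array has to be constructed.
\<close>

lemma prob_consistent:
  assumes h: "h \<in> PiE_dflt pairs False (\<lambda>_. UNIV)"
  shows "measure_pmf.prob (array_pmf n k c q) {f. consistent f h} = pmf (sbm_pmf n c q) h"
proof -
  let ?d = "\<lambda>l. c (node h l)"
  \<comment> \<open>The times before \<open>v\<close> itself is used, that is, the fresh cells of
    its row.\<close>
  define L where "L v = {m. m < n \<and> v \<notin> used h (Suc m)}" for v
  define W where "W v m = pmf (bernoulli_pmf (q (c v) (c (node h m)))) (adjacent h (node h m) v)" for v m
  have mark: "measure_pmf.prob (mark_pmf n k q (c v)) {g. \<forall>m\<in>L v. g (key ?d m) = adjacent h (node h m) v}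
      = (\<Prod>m\<in>L v. W v m)" for v
  proof -
    let ?X = "{1..k} \<times> {..<n}"
    \<comment> \<open>Inverting \<open>key\<close> makes the prescribed value a function of the
      cell, which turns the event into a product set.\<close>
    define b where "b x = adjacent h (node h (inv (key ?d) x)) v" for x
    have b: "b (key ?d m) = adjacent h (node h m) v" for m
      by (simp add: b_def inj_key)
    have sub: "key ?d ` L v \<subseteq> ?X"
    proof (rule image_subsetI)
      fix m assume "m \<in> L v"
      then have m: "m < n" by (simp add: L_def)
      have "card {l. l < m \<and> ?d l = ?d m} \<le> card {..<m}" by (intro card_mono) auto
      then show "key ?d m \<in> ?X" using m c[OF node_less[OF m]] by (simp add: key_def)
    qed
    have "{g. \<forall>m\<in>L v. g (key ?d m) = adjacent h (node h m) v}
        = Pi ?X (\<lambda>x. if x \<in> key ?d ` L v then {b x} else UNIV)"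
    proof (intro subset_antisym subsetI)
      fix g assume "g \<in> {g. \<forall>m\<in>L v. g (key ?d m) = adjacent h (node h m) v}"
      then show "g \<in> Pi ?X (\<lambda>x. if x \<in> key ?d ` L v then {b x} else UNIV)"
        by (auto simp only: Pi_iff b mem_Collect_eq singleton_iff UNIV_I split: if_splits)
    next
      fix g assume g: "g \<in> Pi ?X (\<lambda>x. if x \<in> key ?d ` L v then {b x} else UNIV)"
      have "g (key ?d m) = b (key ?d m)" if "m \<in> L v" for m
      proof -
        have "key ?d m \<in> key ?d ` L v" using that by (rule imageI)
        then show ?thesis using Pi_mem[OF g, of "key ?d m"] sub by auto
      qed
      then show "g \<in> {g. \<forall>m\<in>L v. g (key ?d m) = adjacent h (node h m) v}"
        by (simp only: b mem_Collect_eq) blast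
    qed
    then have "measure_pmf.prob (mark_pmf n k q (c v)) {g. \<forall>m\<in>L v. g (key ?d m) = adjacent h (node h m) v}
        = (\<Prod>x\<in>?X. measure_pmf.prob (case x of (j, s) \<Rightarrow> bernoulli_pmf (q (c v) j)) (if x \<in> key ?d ` L v then {b x} else UNIV))"
      by (simp only: mark_pmf_def) (rule measure_Pi_pmf_Pi, simp)
    also have "\<dots> = (\<Prod>x\<in>key ?d ` L v. pmf (bernoulli_pmf (q (c v) (fst x))) (b x))"
      using sub by (intro prod.mono_neutral_cong_right) (auto simp: measure_pmf_single split: prod.splits)
    also have "\<dots> = (\<Prod>m\<in>L v. W v m)"
      by (subst prod.reindex[OF inj_on_subset[OF inj_key]]) (auto simp: W_def b, simp add: key_def)
    finally show ?thesis .
  qed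
  have "{f. consistent f h} = Pi {..<n} (\<lambda>v. {g. \<forall>m\<in>L v. g (key ?d m) = adjacent h (node h m) v})"
    by (auto simp: consistent_def L_def Pi_def)
  then have "measure_pmf.prob (array_pmf n k c q) {f. consistent f h} = (\<Prod>v\<in>{..<n}. \<Prod>m\<in>L v. W v m)"
    by (simp only: array_pmf_def) (subst measure_Pi_pmf_Pi, simp, simp only: mark)
  also have "\<dots> = (\<Prod>(v, m)\<in>Sigma {..<n} L. W v m)"
    by (rule prod.Sigma) (auto simp: L_def)
  also have "\<dots> = (\<Prod>x\<in>pairs. pmf (case x of (u, v) \<Rightarrow> bernoulli_pmf (q (c u) (c v))) (h x))"
  proof -
    \<comment> \<open>An unordered pair is read once, when its earlier node is used;
      \<open>\<phi>\<close> sends this cell to the representative of the pair in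
      \<open>pairs\<close>.\<close>
    define \<phi> where "\<phi> = (\<lambda>(v, m). (min (node h m) v, max (node h m) v))"
    have L: "m \<in> L (node h l) \<longleftrightarrow> m < l" if "l < n" for l m
      using that by (auto simp: L_def node_in_used_iff)
    have img: "\<phi> ` Sigma {..<n} L = pairs"
    proof (intro subset_antisym subsetI)
      fix x assume "x \<in> \<phi> ` Sigma {..<n} L"
      then obtain v m where x: "x = \<phi> (v, m)" "v < n" "m \<in> L v" by auto
      have "m < n" "node h m \<noteq> v" using x(3) by (auto simp: L_def node_def used.simps)
      then show "x \<in> pairs" using x node_less[of m h] by (auto simp: \<phi>_def min_def max_def)
    next
      fix x assume "x \<in> pairs"
      then obtain a b where x: "x = (a, b)" "a < b" "b < n" by auto
      then have "a \<in> node h ` {..<n}" "b \<in> node h ` {..<n}"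
        using node_bij[of h] by (auto simp: bij_betw_def)
      then obtain l l' where l: "l < n" "a = node h l" "l' < n" "b = node h l'" by auto
      have "l \<noteq> l'" using x l by auto
      then consider "l < l'" | "l' < l" by linarith
      then show "x \<in> \<phi> ` Sigma {..<n} L"
      proof cases
        case 1
        then have "(b, l) \<in> Sigma {..<n} L" "x = \<phi> (b, l)" using L l x by (auto simp: \<phi>_def)
        then show ?thesis by blast
      next
        case 2
        then have "(a, l') \<in> Sigma {..<n} L" "x = \<phi> (a, l')" using L l x by (auto simp: \<phi>_def)
        then show ?thesis by blast
      qed
    qed
    have inj: "inj_on \<phi> (Sigma {..<n} L)"
    proof (rule inj_onI)
      fix x y assume xy: "x \<in> Sigma {..<n} L" "y \<in> Sigma {..<n} L" "\<phi> x = \<phi> y"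
      obtain v m w l where [simp]: "x = (v, m)" "y = (w, l)" by fastforce
      have vw: "v < n" "m < n" "w < n" "l < n" using xy by (auto simp: L_def)
      then have "v \<in> node h ` {..<n}" "w \<in> node h ` {..<n}"
        using node_bij[of h] by (auto simp: bij_betw_def)
      then obtain m' l' where ml: "m' < n" "v = node h m'" "l' < n" "w = node h l'" by auto
      have lt: "m < m'" "l < l'" using xy L ml by auto
      have nodeD: "i = j" if "node h i = node h j" "i < n" "j < n" for i j
        using node_bij[of h] that by (auto simp: bij_betw_def dest: inj_onD)
      have "(node h m = node h l \<and> v = w) \<or> (node h m = w \<and> node h l = v)"
        using xy(3) by (auto simp: \<phi>_def min_def max_def split: if_splits)
      then show "x = y"
      proof
        assume "node h m = w \<and> node h l = v"
        then have "m = l'" "l = m'" using nodeD ml vw by auto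
        then show ?thesis using lt by simp
      next
        assume a: "node h m = node h l \<and> v = w"
        then have "m = l" using nodeD vw by blast
        then show ?thesis using a by simp
      qed
    qed
    have "(\<Prod>x\<in>pairs. pmf (case x of (u, v) \<Rightarrow> bernoulli_pmf (q (c u) (c v))) (h x))
        = (\<Prod>x\<in>Sigma {..<n} L. pmf (case \<phi> x of (u, v) \<Rightarrow> bernoulli_pmf (q (c u) (c v))) (h (\<phi> x)))"
      unfolding img[symmetric] by (simp add: prod.reindex[OF inj] o_def)
    also have "\<dots> = (\<Prod>(v, m)\<in>Sigma {..<n} L. W v m)"
    proof (rule prod.cong[OF refl])
      fix x assume "x \<in> Sigma {..<n} L"
      then obtain v m where x: "x = (v, m)" and v: "v \<in> {..<n}" "m \<in> L v" by auto
      have m: "m < n" "node h m \<noteq> v" using v(2) by (auto simp: L_def node_def used.simps)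
      \<comment> \<open>The later node owns the cell, while the representative orders the pair by
        size, so the two communities may be exchanged.\<close>
      have "q (c (node h m)) (c v) = q (c v) (c (node h m))"
        using q_sym c v node_less[OF m(1)] by auto
      then show "pmf (case \<phi> x of (u, v) \<Rightarrow> bernoulli_pmf (q (c u) (c v))) (h (\<phi> x)) = (case x of (v, m) \<Rightarrow> W v m)"
        unfolding x using m(2) by (auto simp: \<phi>_def W_def adjacent_def min_def max_def)
    qed
    finally show ?thesis by simp
  qed
  also have "\<dots> = pmf (sbm_pmf n c q) h"
    unfolding sbm_pmf_def using h by (subst pmf_Pi'[OF finite_pairs]) (auto simp: PiE_dflt_def)
  finally show ?thesis .
qed

text \<open>The right-hand side no longer mentions a graph: \<open>t\<close> ranges over all vectors
  at which an array could be stuck. Summing \<open>prob_consistent\<close> over the finitely many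
  graphs with property \<open>B\<close> loses nothing, as the events are disjoint, and each array in
  their union is stuck at the vector of its graph.\<close>

lemma coupling:
  "measure_pmf.prob (sbm_pmf n c q) {h. B (\<lambda>i. card (final_active r n h Z \<inter> community n c i))}
     \<le> measure_pmf.prob (array_pmf n k c q)
         {f. \<exists>t. B t \<and> (\<forall>i. card (activated n k c r Z t f i) \<le> t i)}"
proof -
  let ?t = "\<lambda>h i. card (U h \<inter> community n c i)"
  define H where "H = {h \<in> PiE_dflt pairs False (\<lambda>_. UNIV). B (?t h)}"
  have finH: "finite H" by (auto simp: H_def finite_pairs intro!: finite_subset[OF _ finite_PiE_dflt[OF finite_pairs]])
  have supp: "set_pmf (sbm_pmf n c q) \<subseteq> PiE_dflt pairs False (\<lambda>_. UNIV)"
    unfolding sbm_pmf_def using set_Pi_pmf_subset[OF finite_pairs] by (fastforce simp: PiE_dflt_def)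
  have "measure_pmf.prob (sbm_pmf n c q) {h. B (?t h)} = measure_pmf.prob (sbm_pmf n c q) H"
    by (rule measure_pmf.finite_measure_eq_AE) (use supp in \<open>auto simp: AE_measure_pmf_iff H_def\<close>)
  also have "\<dots> = (\<Sum>h\<in>H. pmf (sbm_pmf n c q) h)"
    by (rule measure_measure_pmf_finite[OF finH])
  also have "\<dots> = (\<Sum>h\<in>H. measure_pmf.prob (array_pmf n k c q) {f. consistent f h})"
    by (intro sum.cong refl prob_consistent[symmetric]) (simp add: H_def)
  also have "\<dots> = measure_pmf.prob (array_pmf n k c q) (\<Union>h\<in>H. {f. consistent f h})"
    by (rule measure_pmf.finite_measure_finite_Union[symmetric])
       (use finH consistent_unique in \<open>auto simp: disjoint_family_on_def H_def\<close>)
  also have "\<dots> \<le> measure_pmf.prob (array_pmf n k c q)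
      {f. \<exists>t. B t \<and> (\<forall>i. card (activated n k c r Z t f i) \<le> t i)}"
  proof (rule measure_pmf.finite_measure_mono)
    show "(\<Union>h\<in>H. {f. consistent f h}) \<subseteq> {f. \<exists>t. B t \<and> (\<forall>i. card (activated n k c r Z t f i) \<le> t i)}"
    proof safe
      fix h f assume "h \<in> H" "consistent f h"
      have "card (activated n k c r Z (?t h) f i) \<le> ?t h i" for i
        by (intro card_mono activated_consistent \<open>consistent f h\<close>) (simp add: community_def)
      then show "\<exists>t. B t \<and> (\<forall>i. card (activated n k c r Z t f i) \<le> t i)"
        using \<open>h \<in> H\<close> by (auto simp: H_def intro!: exI[of _ "?t h"])
    qed
  qed simp
  finally show ?thesis .
qed

end

section \<open>The limiting recursion\<close>

definition Phi :: "nat \<Rightarrow> nat \<Rightarrow> (nat \<Rightarrow> real) \<Rightarrow> (nat \<Rightarrow> nat \<Rightarrow> real) \<Rightarrow> nat \<Rightarrow> (nat \<Rightarrow> real) \<Rightarrow> real" where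
  "Phi r k \<alpha> chi i x = \<alpha> i + (1 / real r) * (1 - 1 / real r) ^ (r - 1) * (\<Sum>j\<in>{1..k}. chi i j * x j) ^ r"

primrec iterate :: "nat \<Rightarrow> nat \<Rightarrow> (nat \<Rightarrow> real) \<Rightarrow> (nat \<Rightarrow> nat \<Rightarrow> real) \<Rightarrow> real \<Rightarrow> nat \<Rightarrow> nat \<Rightarrow> real" where
  "iterate r k \<alpha> chi \<theta> 0 = (\<lambda>i. 0)"
| "iterate r k \<alpha> chi \<theta> (Suc m) = (\<lambda>i. \<theta> * Phi r k \<alpha> chi i (iterate r k \<alpha> chi \<theta> m))"

lemma power_diff_ge_mult:
  fixes x y :: real
  assumes "0 \<le> y" "y \<le> x"
  shows "(x - y) * (real (Suc n) * y ^ n) \<le> x ^ Suc n - y ^ Suc n"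
proof -
  have "real (Suc n) * y ^ n = (\<Sum>p<Suc n. y ^ n)" by simp
  also have "\<dots> \<le> (\<Sum>p<Suc n. y ^ (n - p) * x ^ p)"
  proof (rule sum_mono)
    fix p assume "p \<in> {..<Suc n}"
    then have "y ^ n = y ^ (n - p) * y ^ p" by (simp flip: power_add)
    also have "\<dots> \<le> y ^ (n - p) * x ^ p"
      using assms by (intro mult_left_mono power_mono) auto
    finally show "y ^ n \<le> y ^ (n - p) * x ^ p" .
  qed
  finally have "(x - y) * (real (Suc n) * y ^ n) \<le> (x - y) * (\<Sum>p<Suc n. y ^ (n - p) * x ^ p)"
    using assms by (intro mult_left_mono) auto
  then show ?thesis by (subst power_diff_sumr2) simp
qed

locale critical_system =
  fixes r k :: nat and \<alpha> :: "nat \<Rightarrow> real" and chi :: "nat \<Rightarrow> nat \<Rightarrow> real"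
  assumes r: "r \<ge> 2" and k: "k \<ge> 1"
    and \<alpha>: "\<And>i. i \<in> {1..k} \<Longrightarrow> 0 \<le> \<alpha> i"
    and chi: "\<And>i j. \<lbrakk>i \<in> {1..k}; j \<in> {1..k}\<rbrakk> \<Longrightarrow> 0 \<le> chi i j"
    and chi_self: "\<And>i. i \<in> {1..k} \<Longrightarrow> chi i i = 1"
begin

abbreviation \<Phi> where "\<Phi> \<equiv> Phi r k \<alpha> chi"
abbreviation y where "y \<equiv> iterate r k \<alpha> chi"

definition C :: real where "C = (1 / real r) * (1 - 1 / real r) ^ (r - 1)"

lemma C_pos: "C > 0"
  using r by (simp add: C_def)

lemma Phi_eq: "\<Phi> i x = \<alpha> i + C * (\<Sum>j\<in>{1..k}. chi i j * x j) ^ r"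
  by (simp add: Phi_def C_def)

lemma Phi_mono:
  assumes "i \<in> {1..k}" "\<And>j. j \<in> {1..k} \<Longrightarrow> 0 \<le> x j \<and> x j \<le> z j"
  shows "\<Phi> i x \<le> \<Phi> i z"
  unfolding Phi_eq using assms chi C_pos
  by (auto intro!: mult_left_mono power_mono sum_mono sum_nonneg mult_nonneg_nonneg)

lemma Phi_nonneg:
  assumes "i \<in> {1..k}" "\<And>j. j \<in> {1..k} \<Longrightarrow> 0 \<le> x j"
  shows "0 \<le> \<Phi> i x"
  unfolding Phi_eq using assms chi C_pos \<alpha>
  by (auto intro!: add_nonneg_nonneg mult_nonneg_nonneg zero_le_power sum_nonneg)

lemma iterate_nonneg:
  assumes "0 \<le> \<theta>" "i \<in> {1..k}"
  shows "0 \<le> y \<theta> m i"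
  using assms(2) by (induction m arbitrary: i) (auto intro!: mult_nonneg_nonneg Phi_nonneg assms(1))

lemma iterate_Suc_ge:
  assumes "i \<in> {1..k}"
  shows "y 1 m i \<le> y 1 (Suc m) i"
  using assms
proof (induction m arbitrary: i)
  case 0
  then show ?case by (auto intro!: Phi_nonneg)
next
  case (Suc m)
  have "\<Phi> i (y 1 m) \<le> \<Phi> i (y 1 (Suc m))"
    using Suc.prems by (intro Phi_mono conjI Suc.IH iterate_nonneg) auto
  then show ?case by simp
qed

lemma iterate_mono:
  assumes "i \<in> {1..k}" "m \<le> m'"
  shows "y 1 m i \<le> y 1 m' i"
  using assms(2) by (rule lift_Suc_mono_le[of "\<lambda>m. y 1 m i", rotated]) (rule iterate_Suc_ge[OF assms(1)])

lemma iterate_le_prefixed: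
  assumes z: "\<And>j. j \<in> {1..k} \<Longrightarrow> 0 \<le> z j \<and> \<Phi> j z \<le> z j" and "i \<in> {1..k}"
  shows "y 1 m i \<le> z i"
  using assms(2)
proof (induction m arbitrary: i)
  case (Suc m)
  have "\<Phi> i (y 1 m) \<le> \<Phi> i z"
    using Suc by (intro Phi_mono conjI iterate_nonneg) auto
  then show ?case using z[OF Suc.prems] by simp
qed (use z in auto)

text \<open>
  At the least fixed point each diagonal entry of the Jacobian is at most \<open>1\<close>, which is what the
  inequalities of \<open>region\<close> say: otherwise slightly decreasing the \<open>i\<close>-th coordinate would give a
  smaller point that \<open>\<Phi>\<close> does not increase.
\<close>

lemma bounded_iterates_imp_zero:
  assumes B: "\<And>i m. i \<in> {1..k} \<Longrightarrow> y 1 m i \<le> B"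
  shows "\<exists>x\<in>region_rho r k \<alpha> chi. rho r k \<alpha> chi 1 x = 0"
proof -
  define x where "x i = lim (\<lambda>m. y 1 m i)" for i
  have lim: "(\<lambda>m. y 1 m i) \<longlonglongrightarrow> x i" if "i \<in> {1..k}" for i
  proof -
    have "incseq (\<lambda>m. y 1 m i)" using iterate_mono[OF that] by (auto simp: incseq_def)
    then show ?thesis
      using incseq_convergent[of "\<lambda>m. y 1 m i" B] B[OF that] by (metis x_def limI)
  qed
  have x0: "0 \<le> x i" if "i \<in> {1..k}" for i
    by (rule LIMSEQ_le_const[OF lim[OF that]]) (use iterate_nonneg[of 1 i] that in auto)
  have fp: "\<Phi> i x = x i" if i: "i \<in> {1..k}" for i
  proof -
    have "(\<lambda>m. \<Phi> i (y 1 m)) \<longlonglongrightarrow> \<Phi> i x"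
      unfolding Phi_eq by (intro tendsto_intros lim) auto
    moreover have "(\<lambda>m. \<Phi> i (y 1 m)) \<longlonglongrightarrow> x i"
      using LIMSEQ_Suc[OF lim[OF i]] by simp
    ultimately show ?thesis by (rule LIMSEQ_unique)
  qed
  define s where "s i = (\<Sum>j\<in>{1..k}. chi i j * x j)" for i
  have s_split: "s i = x i + (\<Sum>j\<in>{1..k} - {i}. chi i j * x j)" if "i \<in> {1..k}" for i
    unfolding s_def using that by (subst sum.remove[of _ i]) (auto simp: chi_self)
  have xs: "x i \<le> s i" if "i \<in> {1..k}" for i
    using that chi x0 by (auto simp: s_split intro!: sum_nonneg mult_nonneg_nonneg)
  have s_le: "s i \<le> real r / (real r - 1)" if i: "i \<in> {1..k}" for i
  proof (rule ccontr)
    let ?R = "real r / (real r - 1)"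
    assume "\<not> s i \<le> ?R"
    then have s: "s i > ?R" by simp
    have R: "?R > 0" using r by simp
    have xi: "x i = \<alpha> i + C * s i ^ r" using fp[OF i] by (simp add: Phi_eq s_def)
    have "C * s i ^ r > 0" using s R C_pos by (intro mult_pos_pos zero_less_power) auto
    then have "x i > 0" using xi \<alpha>[OF i] by linarith
    \<comment> \<open>The first bound keeps \<open>s i - \<epsilon>\<close> at least
      \<open>r/(r-1)\<close>, where the slope of \<open>C * s ^ r\<close> is at least 1; the second
      keeps \<open>z\<close> nonnegative.\<close>
    define \<epsilon> where "\<epsilon> = min (s i - ?R) (x i)"
    have \<epsilon>: "\<epsilon> > 0" "\<epsilon> \<le> s i - ?R" "\<epsilon> \<le> x i" using s \<open>x i > 0\<close> by (auto simp: \<epsilon>_def)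
    define z where "z = x(i := x i - \<epsilon>)"
    have z: "0 \<le> z j" "z j \<le> x j" if "j \<in> {1..k}" for j using \<epsilon> x0[OF that] by (auto simp: z_def)
    have "\<Phi> j z \<le> z j" if j: "j \<in> {1..k}" for j
    proof (cases "j = i")
      case False
      then show ?thesis using Phi_mono[of j z x] fp[OF j] j z by (simp add: z_def)
    next
      case True
      have "(\<Sum>j\<in>{1..k}. chi i j * z j) = s i - \<epsilon>"
      proof -
        have "(\<Sum>j\<in>{1..k}. chi i j * z j) = chi i i * z i + (\<Sum>j\<in>{1..k} - {i}. chi i j * z j)"
          using i by (intro sum.remove) auto
        also have "(\<Sum>j\<in>{1..k} - {i}. chi i j * z j) = (\<Sum>j\<in>{1..k} - {i}. chi i j * x j)"
          by (intro sum.cong) (auto simp: z_def)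
        finally show ?thesis using i by (simp add: s_split chi_self z_def)
      qed
      then have \<Phi>z: "\<Phi> i z = \<alpha> i + C * (s i - \<epsilon>) ^ r" by (simp add: Phi_eq)
      obtain n where n: "r = Suc n" using r by (cases r) auto
      \<comment> \<open>The slope \<open>C * r * s ^ (r - 1)\<close> equals
        \<open>((1 - 1/r) * s) ^ (r - 1)\<close>, and \<open>r/(r-1)\<close> is where the base is 1.
        Lowering the coordinate by \<open>\<epsilon>\<close> therefore lowers
        \<open>\<Phi> i\<close> by at least \<open>\<epsilon>\<close>.\<close>
      have "1 = ((1 - 1 / real r) * ?R) ^ n" using r by (simp add: field_simps)
      also have "\<dots> \<le> ((1 - 1 / real r) * (s i - \<epsilon>)) ^ n"
        using \<epsilon> R r by (intro power_mono mult_left_mono) auto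
      also have "\<dots> = C * (real (Suc n) * (s i - \<epsilon>) ^ n)"
      proof -
        have "C * real r = (1 - 1 / real r) ^ (r - 1)" using r by (simp add: C_def)
        then show ?thesis by (simp add: n power_mult_distrib mult.assoc[symmetric] del: of_nat_Suc)
      qed
      finally have "\<epsilon> \<le> \<epsilon> * (C * (real (Suc n) * (s i - \<epsilon>) ^ n))"
        using \<epsilon>(1) by simp
      also have "\<dots> = C * ((s i - (s i - \<epsilon>)) * (real (Suc n) * (s i - \<epsilon>) ^ n))" by simp
      also have "\<dots> \<le> C * (s i ^ Suc n - (s i - \<epsilon>) ^ Suc n)"
        using \<epsilon> R C_pos by (intro mult_left_mono power_diff_ge_mult) auto
      finally show ?thesis using True \<Phi>z xi by (simp add: z_def n algebra_simps)
    qed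
    then have "y 1 m i \<le> z i" for m using iterate_le_prefixed[of z i] z i by auto
    then have "x i \<le> z i" using LIMSEQ_le_const2[OF lim[OF i]] by auto
    then show False using \<epsilon> by (simp add: z_def)
  qed
  let ?x = "restrict x {1..k}"
  have rho: "rho r k \<alpha> chi i ?x = 0" if i: "i \<in> {1..k}" for i
  proof -
    have "(\<Sum>j\<in>{1..k}. chi i j * ?x j) = (\<Sum>j\<in>{1..k}. chi i j * x j)"
      by (intro sum.cong) auto
    then show ?thesis using fp[OF i] i by (simp add: rho_def Phi_def)
  qed
  have sum_eq: "(\<Sum>j\<in>{1..k} - {i}. chi i j * ?x j) = (\<Sum>j\<in>{1..k} - {i}. chi i j * x j)" for i
    by (intro sum.cong) auto
  have "?x \<in> region r k chi"
    unfolding region_def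
  proof (intro CollectI conjI ballI restrict_PiE_iff[THEN iffD2])
    show "x i \<in> {0..real r / (real r - 1)}" if "i \<in> {1..k}" for i
      using xs[OF that] s_le[OF that] x0[OF that] by auto
    show "?x i + (\<Sum>j\<in>{1..k} - {i}. chi i j * ?x j) \<le> real r / (real r - 1)" if "i \<in> {1..k}" for i
      unfolding sum_eq using s_le[OF that] s_split[OF that] that by simp
  qed
  then have "?x \<in> region_rho r k \<alpha> chi" using rho by (simp add: region_rho_def)
  moreover have "rho r k \<alpha> chi 1 ?x = 0" using rho k by simp
  ultimately show ?thesis by blast
qed

text \<open>Split the coordinates into the bounded ones \<open>I\<close> and the unbounded ones
  \<open>J\<close>. If both were nonempty, irreducibility would give \<open>chi i j > 0\<close> with
  \<open>i\<close> in \<open>I\<close> and \<open>j\<close> in \<open>J\<close>, and one more step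
  of the recursion would carry the growth of \<open>j\<close> to \<open>i\<close>.\<close>

lemma iterate_unbounded:
  assumes "irreducible_matrix k chi" and "min_rho r k \<alpha> chi > 0" and "i \<in> {1..k}"
  shows "\<exists>m. B < y 1 m i"
proof -
  define I where "I = {i \<in> {1..k}. \<exists>B. \<forall>m. y 1 m i \<le> B}"
  define J where "J = {1..k} - I"
  have "J \<noteq> {}"
  proof
    assume "J = {}"
    then have "\<forall>i\<in>{1..k}. \<exists>B. \<forall>m. y 1 m i \<le> B" by (auto simp: I_def J_def)
    then obtain B where B: "\<And>i m. i \<in> {1..k} \<Longrightarrow> y 1 m i \<le> B i" by metis
    have "y 1 m i \<le> Max (B ` {1..k})" if "i \<in> {1..k}" for i m
      by (rule order.trans[OF B[OF that]]) (use that in auto)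
    from bounded_iterates_imp_zero[OF this]
    obtain x where "x \<in> region_rho r k \<alpha> chi" "rho r k \<alpha> chi 1 x = 0" by blast
    then have "min_rho r k \<alpha> chi \<le> ereal 0" unfolding min_rho_def by (metis INF_lower)
    then show False using assms(2) by (simp add: zero_ereal_def)
  qed
  have "I = {}"
  proof (rule ccontr)
    assume "I \<noteq> {}"
    moreover have "I \<inter> J = {}" "I \<union> J = {1..k}" by (auto simp: I_def J_def)
    ultimately obtain i j where ij: "i \<in> I" "j \<in> J" "chi i j \<noteq> 0"
      using assms(1) \<open>J \<noteq> {}\<close> unfolding irreducible_matrix_def by meson
    have mem: "i \<in> {1..k}" "j \<in> {1..k}" using ij by (auto simp: I_def J_def)
    then have pos: "chi i j > 0" using chi[of i j] ij(3) by simp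
    obtain B where B: "\<And>m. y 1 m i \<le> B" using ij(1) by (auto simp: I_def)
    obtain n where n: "r = Suc n" using r by (cases r) auto
    \<comment> \<open>The bound 1 gives \<open>?S \<le> ?S ^ r\<close>; the bound
      \<open>B / C + 1\<close> makes \<open>C * ?S ^ r\<close> exceed \<open>B\<close>.\<close>
    obtain m where m: "max 1 (B / C + 1) / chi i j < y 1 m j"
      using ij(2) mem by (auto simp: J_def I_def not_le)
    then have "max 1 (B / C + 1) < chi i j * y 1 m j"
      using pos by (simp add: pos_divide_less_eq mult.commute)
    also have "\<dots> \<le> (\<Sum>j\<in>{1..k}. chi i j * y 1 m j)"
      using mem by (intro member_le_sum) (auto intro!: mult_nonneg_nonneg chi iterate_nonneg)
    finally have S: "max 1 (B / C + 1) < (\<Sum>j\<in>{1..k}. chi i j * y 1 m j)" (is "_ < ?S") .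
    have "B / C < ?S" using S by simp
    also have "?S \<le> ?S ^ r" using S n by (intro self_le_power) auto
    finally have "B < C * ?S ^ r" using C_pos by (simp add: pos_divide_less_eq mult.commute)
    also have "\<dots> \<le> y 1 (Suc m) i" using \<alpha>[OF mem(1)] by (simp add: Phi_eq)
    finally show False using B[of "Suc m"] by simp
  qed
  then have "i \<notin> I" by simp
  then show ?thesis using assms(3) by (simp add: I_def not_le)
qed

text \<open>The number of rounds \<open>m\<close> is fixed first, at \<open>\<theta> = 1\<close>.
  For fixed \<open>m\<close> the iterate is a polynomial in \<open>\<theta>\<close>, hence
  continuous, so some \<open>\<theta> < 1\<close> still passes \<open>K\<close>.\<close>

lemma damped_iterate_large:
  assumes "irreducible_matrix k chi" and "min_rho r k \<alpha> chi > 0"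
  obtains \<theta> m where "0 < \<theta>" "\<theta> < 1" "\<And>i. i \<in> {1..k} \<Longrightarrow> K < y \<theta> m i"
proof -
  have "\<forall>i\<in>{1..k}. \<exists>m. K < y 1 m i" using iterate_unbounded[OF assms] by blast
  then obtain M where M: "\<And>i. i \<in> {1..k} \<Longrightarrow> K < y 1 (M i) i" by metis
  define m where "m = (\<Sum>i\<in>{1..k}. M i)"
  have large: "K < y 1 m i" if "i \<in> {1..k}" for i
  proof -
    have "M i \<le> m" unfolding m_def using that by (intro member_le_sum) auto
    then show ?thesis using M[OF that] iterate_mono[OF that, of "M i" m] by linarith
  qed
  have cont: "((\<lambda>\<theta>. y \<theta> m i) \<longlongrightarrow> y 1 m i) (at_left 1)" for m i
    by (induction m arbitrary: i) (auto simp: Phi_eq intro!: tendsto_eq_intros)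
  have "eventually (\<lambda>\<theta>. \<forall>i\<in>{1..k}. K < y \<theta> m i) (at_left 1)"
    by (intro eventually_ball_finite ballI order_tendstoD(1)[OF cont] large) auto
  moreover have "eventually (\<lambda>\<theta>::real. \<theta> \<in> {0<..<1}) (at_left 1)"
    by (rule eventually_at_leftI[of 0]) auto
  ultimately have "eventually (\<lambda>\<theta>. (\<forall>i\<in>{1..k}. K < y \<theta> m i) \<and> \<theta> \<in> {0<..<1}) (at_left 1)"
    by (rule eventually_conj)
  then obtain \<theta> where "(\<forall>i\<in>{1..k}. K < y \<theta> m i) \<and> \<theta> \<in> {0<..<1}"
    by (metis (no_types, lifting) eventually_happens trivial_limit_at_left_real)
  then show ?thesis by (intro that[of \<theta> m]) auto
qed

end

section \<open>Lower tails of the number of marked nodes\<close>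

lemma finite_community [simp]: "finite (community n c i)"
  by (simp add: community_def)

lemma marks_mono:
  assumes "\<And>j. j \<in> {1..k} \<Longrightarrow> t j \<le> t' j"
  shows "marks k t g \<le> marks k t' g"
  unfolding marks_def using assms by (intro card_mono) (force intro: finite_subset[of _ "Sigma {1..k} (\<lambda>j. {..<t' j})"])+

lemma activated_mono:
  assumes "\<And>j. j \<in> {1..k} \<Longrightarrow> t j \<le> t' j"
  shows "activated n k c r Z t f i \<subseteq> activated n k c r Z t' f i"
  unfolding activated_def using marks_mono[OF assms, where g = "f _"] by (auto intro: order.trans)

lemma card_activated_mono:
  assumes "\<And>j. j \<in> {1..k} \<Longrightarrow> t j \<le> t' j"
  shows "card (activated n k c r Z t f i) \<le> card (activated n k c r Z t' f i)"
  by (rule card_mono[OF _ activated_mono[OF assms]]) (simp_all add: activated_def)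

definition mark_prob :: "nat \<Rightarrow> nat \<Rightarrow> (nat \<Rightarrow> nat \<Rightarrow> real) \<Rightarrow> nat \<Rightarrow> (nat \<Rightarrow> nat) \<Rightarrow> nat \<Rightarrow> real" where
  "mark_prob n k q r t i = measure_pmf.prob (mark_pmf n k q i) {g. r \<le> marks k t g}"

lemma mark_prob_mono:
  assumes "\<And>j. j \<in> {1..k} \<Longrightarrow> t j \<le> t' j"
  shows "mark_prob n k q r t i \<le> mark_prob n k q r t' i"
  unfolding mark_prob_def using marks_mono[OF assms]
  by (intro measure_pmf.finite_measure_mono) (auto intro: order.trans)

lemma card_activated:
  "card (activated n k c r Z t f i)
     = card (Z \<inter> community n c i) + card {v \<in> community n c i - Z. r \<le> marks k t (f v)}"
proof -
  have "activated n k c r Z t f i = (Z \<inter> community n c i) \<union> {v \<in> community n c i - Z. r \<le> marks k t (f v)}"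
    by (auto simp: activated_def)
  then show ?thesis by (simp add: card_Un_disjoint Int_def)
qed

lemma activated_tail:
  assumes "0 \<le> \<delta>" "0 \<le> m"
    and m: "m \<le> real (card (community n c i - Z)) * mark_prob n k q r t i"
  shows "measure_pmf.prob (array_pmf n k c q)
           {f. real (card (activated n k c r Z t f i)) \<le> real (card (Z \<inter> community n c i)) + (1 - \<delta>) * m}
         \<le> exp (- (\<delta>\<^sup>2 * m / 2))"
proof -
  let ?V = "community n c i - Z"
  \<comment> \<open>Membership in \<open>?V\<close> is put into the predicate because the product
    law runs over all nodes.\<close>
  let ?Q = "\<lambda>v g. v \<in> ?V \<and> r \<le> marks k t g"
  have "(\<Sum>v<n. measure_pmf.prob (mark_pmf n k q (c v)) {g. ?Q v g})
      = (\<Sum>v\<in>?V. mark_prob n k q r t i)"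
  proof (rule sum.mono_neutral_cong_right)
    show "\<forall>v\<in>{..<n} - ?V. measure_pmf.prob (mark_pmf n k q (c v)) {g. ?Q v g} = 0"
    proof
      fix v assume "v \<in> {..<n} - ?V"
      then have "{g. ?Q v g} = {}" by blast
      then show "measure_pmf.prob (mark_pmf n k q (c v)) {g. ?Q v g} = 0" by (simp only: measure_empty)
    qed
  qed (auto simp: community_def mark_prob_def)
  then have m': "m \<le> (\<Sum>v<n. measure_pmf.prob (mark_pmf n k q (c v)) {g. ?Q v g})"
    using m by simp
  have "{v \<in> {..<n}. ?Q v (f v)} = {v \<in> ?V. r \<le> marks k t (f v)}" for f
    by (auto simp: community_def)
  then have "{f. real (card (activated n k c r Z t f i)) \<le> real (card (Z \<inter> community n c i)) + (1 - \<delta>) * m}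
      = {f. real (card {v \<in> {..<n}. ?Q v (f v)}) \<le> (1 - \<delta>) * m}"
    by (simp add: card_activated)
  then show ?thesis
    unfolding array_pmf_def
    using Pi_pmf_chernoff_lower[of "{..<n}" \<delta> m "\<lambda>v. mark_pmf n k q (c v)" ?Q "\<lambda>_. False"] m' assms
    by simp
qed

lemma sum_Sigma_fst:
  fixes f :: "nat \<Rightarrow> real"
  shows
  "(\<Sum>x\<in>Sigma {1..k} (\<lambda>j. {..<t j}). f (fst x)) = (\<Sum>j\<in>{1..k}. f j * real (t j))"
proof -
  have "(\<Sum>x\<in>Sigma {1..k} (\<lambda>j. {..<t j}). f (fst x)) = (\<Sum>(j, s)\<in>Sigma {1..k} (\<lambda>j. {..<t j}). f j)"
    by (intro sum.cong) auto
  also have "\<dots> = (\<Sum>j\<in>{1..k}. \<Sum>s<t j. f j)" by (intro sum.Sigma[symmetric]) auto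
  finally show ?thesis by (simp add: mult.commute)
qed

text \<open>Exactly \<open>r\<close> marks is the leading case when the mean \<open>l\<close> is
  small. The loss against \<open>l ^ r / fact r\<close> is a factor \<open>1 - l\<close> and a shift
  \<open>r * b\<close>, both negligible on the scale \<open>g\<close>.\<close>

lemma mark_prob_ge_small:
  assumes q: "\<And>j. j \<in> {1..k} \<Longrightarrow> 0 \<le> q i j \<and> q i j \<le> b" and b: "0 \<le> b" "b \<le> 1"
    and t: "\<And>j. j \<in> {1..k} \<Longrightarrow> t j \<le> n"
    and l: "l = (\<Sum>j\<in>{1..k}. q i j * real (t j))" "l \<le> 1"
  shows "(1 - l) * (max 0 (l - real r * b) ^ r / fact r) \<le> mark_prob n k q r t i"
proof -
  let ?X = "Sigma {1..k} (\<lambda>j. {..<t j})"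
  let ?P = "\<lambda>X. Pi_pmf X False (\<lambda>x. bernoulli_pmf (q i (fst x)))"
  have sub: "?X \<subseteq> {1..k} \<times> {..<n}" using t by fastforce
  have "(1 - l) * (max 0 (l - real r * b) ^ r / fact r)
      \<le> measure_pmf.prob (?P ?X) {g. card {x \<in> ?X. g x} = r}"
    unfolding l(1) sum_Sigma_fst[symmetric]
    by (rule prob_card_eq_lower) (use q b l in \<open>auto simp: sum_Sigma_fst[unfolded One_nat_def]\<close>)
  also have "\<dots> \<le> measure_pmf.prob (?P ?X) {g. r \<le> marks k t g}"
    by (intro measure_pmf.finite_measure_mono) (auto simp: marks_def)
  \<comment> \<open>\<open>mark_pmf\<close> fills the full rectangle, while \<open>marks\<close>
    reads only the block \<open>?X\<close>; the other cells are integrated out.\<close>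
  also have "?P ?X = map_pmf (\<lambda>f x. if x \<in> ?X then f x else False) (?P ({1..k} \<times> {..<n}))"
    by (rule Pi_pmf_subset[OF _ sub]) simp
  also have "?P ({1..k} \<times> {..<n}) = mark_pmf n k q i"
    unfolding mark_pmf_def by (intro Pi_pmf_cong) auto
  also have "measure_pmf.prob (map_pmf (\<lambda>f x. if x \<in> ?X then f x else False) (mark_pmf n k q i)) {g. r \<le> marks k t g}
      = mark_prob n k q r t i"
  proof -
    have "{x \<in> ?X. if x \<in> ?X then g x else False} = {x \<in> ?X. g x}" for g by auto
    then have "marks k t (\<lambda>x. if x \<in> ?X then g x else False) = marks k t g" for g
      by (simp only: marks_def)
    then show ?thesis by (simp only: measure_map_pmf vimage_def mem_Collect_eq mark_prob_def)
  qed
  finally show ?thesis .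
qed

text \<open>As \<open>r \<le> l / 2\<close>, having fewer than \<open>r\<close> marks is a deviation
  by at least half of the mean.\<close>

lemma mark_prob_ge_large:
  assumes q: "\<And>j. j \<in> {1..k} \<Longrightarrow> 0 \<le> q i j \<and> q i j \<le> 1"
    and t: "\<And>j. j \<in> {1..k} \<Longrightarrow> t j \<le> n"
    and l: "l = (\<Sum>j\<in>{1..k}. q i j * real (t j))" "2 * real r \<le> l"
  shows "1 - exp (- l / 8) \<le> mark_prob n k q r t i"
proof -
  let ?X = "Sigma {1..k} (\<lambda>j. {..<t j})"
  let ?Y = "{1..k} \<times> {..<n}"
  have sub: "?X \<subseteq> ?Y" using t by fastforce
  let ?Q = "\<lambda>x y. x \<in> ?X \<and> y"
  have "(\<Sum>x\<in>?Y. measure_pmf.prob (case x of (j, s) \<Rightarrow> bernoulli_pmf (q i j)) {y. ?Q x y})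
      = (\<Sum>x\<in>?X. q i (fst x))"
  proof (rule sum.mono_neutral_cong_right[OF _ sub])
    fix x assume x: "x \<in> ?X"
    then have "measure_pmf.prob (bernoulli_pmf (q i (fst x))) {y. ?Q x y}
      = measure_pmf.prob (bernoulli_pmf (q i (fst x))) {True}"
      by (intro arg_cong[where f = "measure_pmf.prob _"]) auto
    then show "measure_pmf.prob (case x of (j, s) \<Rightarrow> bernoulli_pmf (q i j)) {y. ?Q x y} = q i (fst x)"
      using x q by (auto simp: measure_pmf_single split: prod.splits)
  qed auto
  then have "l \<le> (\<Sum>x\<in>?Y. measure_pmf.prob (case x of (j, s) \<Rightarrow> bernoulli_pmf (q i j)) {y. ?Q x y})"
    unfolding sum_Sigma_fst l by simp
  from Pi_pmf_chernoff_lower[of ?Y "1/2" l _ ?Q False, OF _ _ _ this]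
  have ch: "measure_pmf.prob (mark_pmf n k q i) {f. real (card {x \<in> ?Y. ?Q x (f x)}) \<le> (1 - 1 / 2) * l} \<le> exp (- ((1/2)\<^sup>2 * l / 2))"
    using l(2) by (simp add: mark_pmf_def)
  have eq: "{x \<in> ?Y. ?Q x (g x)} = {x \<in> ?X. g x}" for g using sub by auto
  have "1 - mark_prob n k q r t i = measure_pmf.prob (mark_pmf n k q i) (UNIV - {g. r \<le> marks k t g})"
    unfolding mark_prob_def using measure_pmf.prob_compl[of "{g. r \<le> marks k t g}" "mark_pmf n k q i"] by simp
  also have "\<dots> \<le> measure_pmf.prob (mark_pmf n k q i) {f. real (card {x \<in> ?Y. ?Q x (f x)}) \<le> (1 - 1 / 2) * l}"
    unfolding eq using l(2) by (intro measure_pmf.finite_measure_mono) (auto simp: marks_def)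
  also have "\<dots> \<le> exp (- ((1/2)\<^sup>2 * l / 2))" by (rule ch)
  also have "\<dots> = exp (- l / 8)" by (simp add: power2_eq_square)
  finally show ?thesis by simp
qed

section \<open>Asymptotics of the parameters\<close>

locale sbm_sequence =
  fixes r k :: nat
    and c N a :: "nat \<Rightarrow> nat \<Rightarrow> nat"
    and q :: "nat \<Rightarrow> nat \<Rightarrow> nat \<Rightarrow> real"
    and p :: "nat \<Rightarrow> nat \<Rightarrow> real"
    and \<alpha> :: "nat \<Rightarrow> real"
    and \<nu> \<mu> \<gamma> chi :: "nat \<Rightarrow> nat \<Rightarrow> real"
  assumes r: "r \<ge> 2" and k: "k \<ge> 1"
    and c: "\<And>n v. \<lbrakk>n \<ge> k; v < n\<rbrakk> \<Longrightarrow> c n v \<in> {1..k}"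
    and N: "\<And>n i. N n i = card (community n (c n) i)"
    and N_pos: "\<And>n i. \<lbrakk>n \<ge> k; i \<in> {1..k}\<rbrakk> \<Longrightarrow> N n i \<ge> 1"
    and q_sym: "\<And>n i j. \<lbrakk>n \<ge> k; i \<in> {1..k}; j \<in> {1..k}\<rbrakk> \<Longrightarrow> q n i j = q n j i"
    and q_bounds: "\<And>n i j. \<lbrakk>n \<ge> k; i \<in> {1..k}; j \<in> {1..k}\<rbrakk> \<Longrightarrow> 0 \<le> q n i j \<and> q n i j < 1"
    and p: "\<And>n i. p n i = q n i i"
    and a_le: "\<And>n i. \<lbrakk>n \<ge> k; i \<in> {1..k}\<rbrakk> \<Longrightarrow> a n i \<le> N n i"
    and N_ratio: "\<And>i j. \<lbrakk>i \<in> {1..k}; j \<in> {1..k}\<rbrakk> \<Longrightarrow>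
           (\<lambda>n. real (N n i) / real (N n j)) \<longlonglongrightarrow> \<nu> i j \<and> 0 < \<nu> i j"
    and p_lower: "\<And>i. i \<in> {1..k} \<Longrightarrow> (\<lambda>n. 1 / real (N n i)) \<in> o(\<lambda>n. p n i)"
    and p_upper: "\<And>i. i \<in> {1..k} \<Longrightarrow>
           \<exists>r'::real. 1 < r' \<and> r' < real r \<and> (\<lambda>n. p n i) \<in> O(\<lambda>n. real (N n i) powr (- 1 / r'))"
    and q_le: "\<And>n i j. \<lbrakk>n \<ge> k; i \<in> {1..k}; j \<in> {1..k}\<rbrakk> \<Longrightarrow> q n i j \<le> min (p n i) (p n j)"
    and q_ratio: "\<And>i j. \<lbrakk>i \<in> {1..k}; j \<in> {1..k}\<rbrakk> \<Longrightarrow> (\<lambda>n. q n i j / p n i) \<longlonglongrightarrow> \<gamma> i j"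
    and p_ratio: "\<And>i j. \<lbrakk>i \<in> {1..k}; j \<in> {1..k}\<rbrakk> \<Longrightarrow>
           (\<lambda>n. p n i / p n j) \<longlonglongrightarrow> \<mu> i j \<and> 0 < \<mu> i j"
    and a_ratio: "\<And>i. i \<in> {1..k} \<Longrightarrow>
           (\<lambda>n. real (a n i) / critical_seeds r (N n i) (p n i)) \<longlonglongrightarrow> \<alpha> i \<and> 0 \<le> \<alpha> i"
    and chi: "\<And>i j. chi i j =
           lim (\<lambda>n. q n i j * critical_seeds r (N n j) (p n j)
                      / (p n i * critical_seeds r (N n i) (p n i)))"
begin

abbreviation g :: "nat \<Rightarrow> nat \<Rightarrow> real" where
  "g n i \<equiv> critical_seeds r (N n i) (p n i)"

lemma N_sum:
  assumes "n \<ge> k"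
  shows "(\<Sum>i\<in>{1..k}. N n i) = n"
proof -
  have "(\<Union>i\<in>{1..k}. community n (c n) i) = {..<n}"
    using c[OF assms] by (auto simp: community_def)
  moreover have "card (\<Union>i\<in>{1..k}. community n (c n) i) = (\<Sum>i\<in>{1..k}. N n i)"
    unfolding N by (rule card_UN_disjoint) (auto simp: community_def)
  ultimately show ?thesis by simp
qed

lemma N_le:
  assumes "n \<ge> k" "i \<in> {1..k}"
  shows "N n i \<le> n"
  using member_le_sum[of i "{1..k}" "N n"] N_sum[OF assms(1)] assms(2) by simp

lemma N_ge_linear:
  assumes i: "i \<in> {1..k}"
  obtains V :: real where "V > 0" "eventually (\<lambda>n. real n \<le> V * real (N n i)) sequentially"
proof -
  let ?V = "(\<Sum>j\<in>{1..k}. \<nu> j i)"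
  have V: "?V \<ge> 0" using N_ratio i by (intro sum_nonneg) (auto intro: less_imp_le)
  have "(\<lambda>n. \<Sum>j\<in>{1..k}. real (N n j) / real (N n i)) \<longlonglongrightarrow> ?V"
    using N_ratio i by (intro tendsto_sum) auto
  then have "eventually (\<lambda>n. (\<Sum>j\<in>{1..k}. real (N n j) / real (N n i)) < ?V + 1) sequentially"
    by (rule order_tendstoD) simp
  moreover have "eventually (\<lambda>n. n \<ge> k) sequentially" by (rule eventually_ge_at_top)
  ultimately have "eventually (\<lambda>n. real n \<le> (?V + 1) * real (N n i)) sequentially"
  proof eventually_elim
    case (elim n)
    have "(\<Sum>j\<in>{1..k}. real (N n j) / real (N n i)) = real n / real (N n i)"
      using N_sum[OF elim(2)] by (simp flip: sum_divide_distrib of_nat_sum)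
    moreover have "N n i \<ge> 1" by (rule N_pos[OF elim(2) i])
    ultimately show ?case using elim(1) by (simp add: divide_less_eq)
  qed
  then show ?thesis using that[of "?V + 1"] V by simp
qed

lemma p_nonneg: "\<lbrakk>n \<ge> k; i \<in> {1..k}\<rbrakk> \<Longrightarrow> 0 \<le> p n i"
  using q_bounds by (simp add: p)

lemma Np_at_top:
  assumes i: "i \<in> {1..k}"
  shows "filterlim (\<lambda>n. real (N n i) * p n i) at_top sequentially"
proof (rule filterlim_at_top[THEN iffD2], rule allI)
  fix Z :: real
  define Z' where "Z' = max Z 1"
  have "eventually (\<lambda>n. norm (1 / real (N n i)) \<le> 1 / Z' * norm (p n i)) sequentially"
    using p_lower[OF i] by (rule landau_o.smallD) (simp add: Z'_def)
  moreover have "eventually (\<lambda>n. n \<ge> k) sequentially" by (rule eventually_ge_at_top)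
  ultimately show "eventually (\<lambda>n. Z \<le> real (N n i) * p n i) sequentially"
  proof eventually_elim
    case (elim n)
    have "N n i \<ge> 1" "0 \<le> p n i" using N_pos p_nonneg elim(2) i by auto
    then have "Z' \<le> real (N n i) * p n i" using elim(1) by (simp add: field_simps Z'_def)
    then show ?case by (simp add: Z'_def)
  qed
qed

lemma p_pos:
  assumes i: "i \<in> {1..k}"
  shows "eventually (\<lambda>n. 0 < p n i) sequentially"
proof -
  have "eventually (\<lambda>n. 0 < real (N n i) * p n i) sequentially"
    using Np_at_top[OF i] by (simp add: filterlim_at_top_dense)
  then show ?thesis
    by (rule eventually_mono) (auto simp: zero_less_mult_iff)
qed

lemma g_pos:
  assumes i: "i \<in> {1..k}"
  shows "eventually (\<lambda>n. 0 < g n i) sequentially"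
  using p_pos[OF i] eventually_ge_at_top[of k]
proof eventually_elim
  case (elim n)
  then show ?case using N_pos[OF elim(2) i] r by (simp add: critical_seeds_def)
qed

lemma g_identity:
  assumes i: "i \<in> {1..k}"
  shows "eventually (\<lambda>n. real (N n i) * p n i ^ r * g n i ^ (r - 1)
           = (1 - 1 / real r) ^ (r - 1) * fact (r - 1)) sequentially"
  using p_pos[OF i] eventually_ge_at_top[of k]
proof eventually_elim
  case (elim n)
  define D where "D = real (N n i) * p n i ^ r"
  have D: "D > 0" using elim N_pos[OF elim(2) i] by (simp add: D_def)
  have "((fact (r - 1) / D) powr (1 / (real r - 1))) ^ (r - 1)
      = (fact (r - 1) / D) powr (1 / (real r - 1) * real (r - 1))"
    using D by (simp add: powr_powr flip: powr_realpow)
  also have "1 / (real r - 1) * real (r - 1) = 1" using r by (simp add: of_nat_diff)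
  finally have "((fact (r - 1) / D) powr (1 / (real r - 1))) ^ (r - 1) = fact (r - 1) / D"
    using D by simp
  then have "D * g n i ^ (r - 1) = D * ((1 - 1 / real r) ^ (r - 1) * (fact (r - 1) / D))"
    by (simp add: critical_seeds_def power_mult_distrib flip: D_def)
  also have "\<dots> = (1 - 1 / real r) ^ (r - 1) * fact (r - 1)" using D by simp
  finally show ?case by (simp add: D_def)
qed

text \<open>By \<open>g_identity\<close>, \<open>(p * g) ^ (r - 1)\<close> is a constant divided by
  \<open>N * p\<close>, which tends to infinity. So on the scale \<open>g\<close> the mean number of
  marks of a node tends to 0, the regime of \<open>mark_prob_ge_small\<close>.\<close>

lemma pg_tendsto_0:
  assumes i: "i \<in> {1..k}"
  shows "(\<lambda>n. p n i * g n i) \<longlonglongrightarrow> 0"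
proof (rule tendstoI)
  fix e :: real assume e: "e > 0"
  let ?C = "(1 - 1 / real r) ^ (r - 1) * fact (r - 1)"
  have "(\<lambda>n. ?C / (real (N n i) * p n i)) \<longlonglongrightarrow> 0"
    by (rule tendsto_divide_0[OF tendsto_const filterlim_at_top_imp_at_infinity[OF Np_at_top[OF i]]])
  then have "eventually (\<lambda>n. ?C / (real (N n i) * p n i) < e ^ (r - 1)) sequentially"
    by (rule order_tendstoD) (use e in simp)
  then show "eventually (\<lambda>n. dist (p n i * g n i) 0 < e) sequentially"
    using g_identity[OF i] p_pos[OF i] g_pos[OF i] eventually_ge_at_top[of k]
  proof eventually_elim
    case (elim n)
    have Np: "real (N n i) * p n i > 0" using elim N_pos[OF elim(5) i] by simp
    have eq: "real (N n i) * p n i * (p n i * g n i) ^ (r - 1) = ?C"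
    proof -
      have "p n i ^ r = p n i * p n i ^ (r - 1)" using r by (cases r) auto
      then show ?thesis using elim(2) by (simp add: power_mult_distrib mult_ac)
    qed
    have "(p n i * g n i) ^ (r - 1) = ?C / (real (N n i) * p n i)"
      unfolding eq[symmetric] by (rule nonzero_mult_div_cancel_left[symmetric]) (use Np in linarith)
    then have "(p n i * g n i) ^ (r - 1) < e ^ (r - 1)" using elim(1) by simp
    then have "p n i * g n i < e" by (rule power_less_imp_less_base) (use e in simp)
    then show ?case using elim by (simp add: dist_real_def)
  qed
qed

text \<open>The bound on \<open>p\<close> gives
  \<open>N * p ^ r \<le> B ^ r * N powr (1 - r / r')\<close>, where the exponent is negative as
  \<open>r' < r\<close>. The reciprocal, raised to \<open>1 / (r - 1)\<close>, is a positive power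
  of \<open>N\<close>, and \<open>N\<close> is comparable to \<open>n\<close>.\<close>

lemma g_ge_powr:
  assumes i: "i \<in> {1..k}"
  obtains C \<kappa> :: real where "C > 0" "\<kappa> > 0" "eventually (\<lambda>n. C * real n powr \<kappa> \<le> g n i) sequentially"
proof -
  obtain r' :: real where r': "1 < r'" "r' < real r" "(\<lambda>n. p n i) \<in> O(\<lambda>n. real (N n i) powr (- 1 / r'))"
    using p_upper[OF i] by blast
  then obtain B where B: "B > 0" "eventually (\<lambda>n. norm (p n i) \<le> B * norm (real (N n i) powr (- 1 / r'))) sequentially"
    by (auto elim: landau_o.bigE)
  obtain V :: real where V: "V > 0" "eventually (\<lambda>n. real n \<le> V * real (N n i)) sequentially"
    by (rule N_ge_linear[OF i])
  define e where "e = real r / r' - 1"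
  have e: "e > 0" using r' by (simp add: e_def)
  define s where "s = 1 / (real r - 1)"
  have s: "s > 0" using r by (simp add: s_def)
  define C where "C = (1 - 1 / real r) * ((fact (r - 1) / B ^ r) powr s * (1 / V) powr (e * s))"
  have "C > 0" using r B V by (simp add: C_def)
  moreover have "e * s > 0" using e s by simp
  moreover have "eventually (\<lambda>n. C * real n powr (e * s) \<le> g n i) sequentially"
    using B(2) V(2) p_pos[OF i] eventually_ge_at_top[of k]
  proof eventually_elim
    case (elim n)
    have N1: "real (N n i) > 0" using N_pos[OF elim(4) i] by simp
    have "real (N n i) * p n i ^ r \<le> real (N n i) * (B * real (N n i) powr (- 1 / r')) ^ r"
      using elim B(1) N1 by (intro mult_left_mono power_mono) auto
    also have "\<dots> = B ^ r * (real (N n i) powr 1 * (real (N n i) powr (- 1 / r')) ^ r)"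
      using N1 by (simp add: power_mult_distrib)
    also have "(real (N n i) powr (- 1 / r')) ^ r = real (N n i) powr (- (real r / r'))"
      using N1 by (simp add: powr_powr flip: powr_realpow)
    also have "real (N n i) powr 1 * real (N n i) powr (- (real r / r')) = real (N n i) powr (- e)"
      by (simp only: e_def powr_add[symmetric]) simp
    finally have le: "real (N n i) * p n i ^ r \<le> B ^ r * real (N n i) powr (- e)" .
    have "(fact (r - 1) / B ^ r) * (1 / V * real n) powr e \<le> (fact (r - 1) / B ^ r) * real (N n i) powr e"
      using B(1) V(1) elim(2) e by (intro mult_left_mono powr_mono2) (auto simp: field_simps)
    also have "\<dots> = fact (r - 1) / (B ^ r * real (N n i) powr (- e))"
      by (simp add: powr_minus field_simps)
    also have "\<dots> \<le> fact (r - 1) / (real (N n i) * p n i ^ r)"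
      using le elim N1 B(1) by (intro divide_left_mono) auto
    finally have "((fact (r - 1) / B ^ r) * (1 / V * real n) powr e) powr s
        \<le> (fact (r - 1) / (real (N n i) * p n i ^ r)) powr s"
      using s B(1) by (intro powr_mono2) auto
    also have "((fact (r - 1) / B ^ r) * (1 / V * real n) powr e) powr s
        = (fact (r - 1) / B ^ r) powr s * (1 / V) powr (e * s) * real n powr (e * s)"
      by (simp only: powr_mult powr_powr mult.assoc)
    finally have "(1 - 1 / real r) * ((fact (r - 1) / B ^ r) powr s * (1 / V) powr (e * s) * real n powr (e * s))
        \<le> (1 - 1 / real r) * (fact (r - 1) / (real (N n i) * p n i ^ r)) powr s"
      using r by (intro mult_left_mono) auto
    then show ?case by (simp add: C_def critical_seeds_def s_def mult.assoc)
  qed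
  ultimately show ?thesis by (rule that)
qed

lemma g_at_top:
  assumes i: "i \<in> {1..k}"
  shows "filterlim (\<lambda>n. g n i) at_top sequentially"
proof -
  obtain C \<kappa> :: real where C: "C > 0" "\<kappa> > 0" "eventually (\<lambda>n. C * real n powr \<kappa> \<le> g n i) sequentially"
    by (rule g_ge_powr[OF i])
  have "filterlim (\<lambda>n. C * real n powr \<kappa>) at_top sequentially" using C(1,2) by real_asymp
  then show ?thesis by (rule filterlim_at_top_mono[OF _ C(3)])
qed

text \<open>The factor \<open>Suc n\<close> pays for a union bound over all possible values of one
  coordinate of the stopping vector.\<close>

lemma summable_exp_g:
  assumes i: "i \<in> {1..k}" and d: "d > 0"
  shows "summable (\<lambda>n. real (Suc n) * exp (- d * g n i))"
proof -
  obtain C \<kappa> :: real where C: "C > 0" "\<kappa> > 0" "eventually (\<lambda>n. C * real n powr \<kappa> \<le> g n i) sequentially"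
    by (rule g_ge_powr[OF i])
  have "(\<lambda>n. real (Suc n) * exp (- d * (C * real n powr \<kappa>))) \<in> O(\<lambda>n. 1 / real n ^ 2)"
    using d C(1,2) by real_asymp
  then have sum: "summable (\<lambda>n. real (Suc n) * exp (- d * (C * real n powr \<kappa>)))"
    by (rule summable_comparison_test_bigo[rotated]) (use inverse_power_summable[of 2, where 'a = real] in \<open>simp add: inverse_eq_divide\<close>)
  show ?thesis
  proof (rule summable_comparison_test_ev[OF _ sum])
    show "eventually (\<lambda>n. norm (real (Suc n) * exp (- d * g n i)) \<le> real (Suc n) * exp (- d * (C * real n powr \<kappa>))) sequentially"
      using C(3) by eventually_elim (use d in \<open>auto intro!: mult_left_mono\<close>)
  qed
qed

lemma p_tendsto_0:
  assumes i: "i \<in> {1..k}"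
  shows "(\<lambda>n. p n i) \<longlonglongrightarrow> 0"
proof (rule tendsto_sandwich[OF _ _ tendsto_const pg_tendsto_0[OF i]])
  show "eventually (\<lambda>n. 0 \<le> p n i) sequentially"
    using p_pos[OF i] by eventually_elim simp
  have "eventually (\<lambda>n. 1 \<le> g n i) sequentially"
    using g_at_top[OF i] by (simp add: filterlim_at_top)
  then show "eventually (\<lambda>n. p n i \<le> p n i * g n i) sequentially"
    using p_pos[OF i] by eventually_elim simp
qed

lemma g_over_N_tendsto_0:
  assumes i: "i \<in> {1..k}"
  shows "(\<lambda>n. g n i / real (N n i)) \<longlonglongrightarrow> 0"
proof -
  have "(\<lambda>n. p n i * g n i / (real (N n i) * p n i)) \<longlonglongrightarrow> 0"
    by (rule real_tendsto_divide_at_top[OF pg_tendsto_0[OF i] Np_at_top[OF i]])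
  moreover have "eventually (\<lambda>n. p n i * g n i / (real (N n i) * p n i) = g n i / real (N n i)) sequentially"
    using p_pos[OF i] by eventually_elim simp
  ultimately show ?thesis by (rule Lim_transform_eventually)
qed

lemma a_over_N_tendsto_0:
  assumes i: "i \<in> {1..k}"
  shows "(\<lambda>n. real (a n i) / real (N n i)) \<longlonglongrightarrow> 0"
proof -
  have "(\<lambda>n. (real (a n i) / g n i) * (g n i / real (N n i))) \<longlonglongrightarrow> \<alpha> i * 0"
    using a_ratio[OF i] g_over_N_tendsto_0[OF i] by (intro tendsto_mult) auto
  moreover have "eventually (\<lambda>n. (real (a n i) / g n i) * (g n i / real (N n i)) = real (a n i) / real (N n i)) sequentially"
    using g_pos[OF i] by eventually_elim simp
  ultimately show ?thesis using Lim_transform_eventually by fastforce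
qed

text \<open>\<open>chi\<close> is given by \<open>lim\<close>, which carries information only once
  convergence is known. The ratio \<open>g n j / g n i\<close> is a continuous function of the
  ratios of \<open>N\<close> and of \<open>p\<close>, so the limit exists.\<close>

lemma chi_lim:
  assumes ij: "i \<in> {1..k}" "j \<in> {1..k}"
  shows "(\<lambda>n. q n i j * g n j / (p n i * g n i)) \<longlonglongrightarrow> chi i j"
proof -
  define s where "s = 1 / (real r - 1)"
  have "(\<lambda>n. (real (N n i) / real (N n j) * (p n i / p n j) ^ r) powr s)
      \<longlonglongrightarrow> (\<nu> i j * \<mu> i j ^ r) powr s"
    using N_ratio[OF ij] p_ratio[OF ij] by (intro tendsto_intros) auto
  moreover have "eventually (\<lambda>n. (real (N n i) / real (N n j) * (p n i / p n j) ^ r) powr s = g n j / g n i) sequentially"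
    using p_pos[OF ij(1)] p_pos[OF ij(2)] eventually_ge_at_top[of k]
  proof eventually_elim
    case (elim n)
    have pos: "real (N n i) * p n i ^ r > 0" "real (N n j) * p n j ^ r > 0"
      using N_pos[OF elim(3)] ij elim by (auto simp: Suc_le_eq)
    have "g n j / g n i = (fact (r - 1) / (real (N n j) * p n j ^ r)) powr s / (fact (r - 1) / (real (N n i) * p n i ^ r)) powr s"
      using r by (simp add: critical_seeds_def s_def)
    also have "\<dots> = ((fact (r - 1) / (real (N n j) * p n j ^ r)) / (fact (r - 1) / (real (N n i) * p n i ^ r))) powr s"
      by (rule powr_divide[symmetric])
    also have "(fact (r - 1) / (real (N n j) * p n j ^ r)) / (fact (r - 1) / (real (N n i) * p n i ^ r))
        = real (N n i) / real (N n j) * (p n i / p n j) ^ r"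
      using pos by (simp add: field_simps power_divide)
    finally show ?case by simp
  qed
  ultimately have "(\<lambda>n. g n j / g n i) \<longlonglongrightarrow> (\<nu> i j * \<mu> i j ^ r) powr s"
    by (rule Lim_transform_eventually)
  then have "(\<lambda>n. (q n i j / p n i) * (g n j / g n i)) \<longlonglongrightarrow> \<gamma> i j * (\<nu> i j * \<mu> i j ^ r) powr s"
    by (intro tendsto_mult q_ratio ij)
  then have "(\<lambda>n. q n i j * g n j / (p n i * g n i)) \<longlonglongrightarrow> \<gamma> i j * (\<nu> i j * \<mu> i j ^ r) powr s"
    by simp
  then show ?thesis unfolding chi by (simp add: limI)
qed

lemma chi_nonneg:
  assumes ij: "i \<in> {1..k}" "j \<in> {1..k}"
  shows "0 \<le> chi i j"
proof (rule tendsto_lowerbound[OF chi_lim[OF ij]])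
  show "eventually (\<lambda>n. 0 \<le> q n i j * g n j / (p n i * g n i)) sequentially"
    using p_pos[OF ij(1)] g_pos[OF ij(1)] g_pos[OF ij(2)] eventually_ge_at_top[of k]
    by eventually_elim (use q_bounds ij in auto)
qed simp

lemma chi_self:
  assumes i: "i \<in> {1..k}"
  shows "chi i i = 1"
proof -
  have "eventually (\<lambda>n. q n i i * g n i / (p n i * g n i) = 1) sequentially"
    using p_pos[OF i] g_pos[OF i] by eventually_elim (simp add: p)
  then have "(\<lambda>n. q n i i * g n i / (p n i * g n i)) \<longlonglongrightarrow> 1"
    by (rule tendsto_eventually)
  then show ?thesis using chi_lim[OF i i] LIMSEQ_unique by blast
qed

section \<open>Growth of the set of active nodes\<close>

text \<open>From here on the seeds are fixed. The estimates use them only through their number in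
  each community, so they are uniform over all such \<open>Z\<close>.\<close>

definition valid_seeds :: "nat \<Rightarrow> nat set \<Rightarrow> bool" where
  "valid_seeds n Z \<longleftrightarrow> Z \<subseteq> {..<n} \<and> (\<forall>i\<in>{1..k}. card (Z \<inter> community n (c n) i) = a n i)"

lemma card_nonseeds:
  assumes "valid_seeds n Z" "i \<in> {1..k}"
  shows "card (community n (c n) i - Z) = N n i - a n i"
  using assms by (simp add: card_Diff_subset_Int valid_seeds_def N Int_commute)

lemma real_card_nonseeds:
  assumes "valid_seeds n Z" "i \<in> {1..k}" "n \<ge> k"
  shows "real (card (community n (c n) i - Z)) = real (N n i) - real (a n i)"
  using card_nonseeds[OF assms(1,2)] a_le[OF assms(3,2)] by simp

lemma floor_ratio_tendsto:
  assumes j: "j \<in> {1..k}" and x: "x \<ge> 0"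
  shows "(\<lambda>n. real (nat \<lfloor>x * g n j\<rfloor>) / g n j) \<longlonglongrightarrow> x"
proof (rule tendsto_sandwich)
  show "eventually (\<lambda>n. x - 1 / g n j \<le> real (nat \<lfloor>x * g n j\<rfloor>) / g n j) sequentially"
    using g_pos[OF j]
  proof eventually_elim
    case (elim n)
    have "x * g n j - 1 \<le> real (nat \<lfloor>x * g n j\<rfloor>)" by linarith
    then have "(x * g n j - 1) / g n j \<le> real (nat \<lfloor>x * g n j\<rfloor>) / g n j"
      using elim by (intro divide_right_mono) auto
    then show ?case using elim by (simp add: diff_divide_distrib)
  qed
  show "eventually (\<lambda>n. real (nat \<lfloor>x * g n j\<rfloor>) / g n j \<le> x) sequentially"
    using g_pos[OF j]
  proof eventually_elim
    case (elim n)
    have "x * g n j \<ge> 0" using elim x by simp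
    then have "real (nat \<lfloor>x * g n j\<rfloor>) \<le> x * g n j" by linarith
    then show ?case using elim by (simp add: divide_le_eq)
  qed
  have "(\<lambda>n. 1 / g n j) \<longlonglongrightarrow> 0"
    by (rule real_tendsto_divide_at_top[OF tendsto_const g_at_top[OF j]])
  then show "(\<lambda>n. x - 1 / g n j) \<longlonglongrightarrow> x"
    using tendsto_diff[OF tendsto_const[of x]] by fastforce
qed simp

lemma floor_le_n:
  assumes j: "j \<in> {1..k}" and x: "x \<ge> 0"
  shows "eventually (\<lambda>n. nat \<lfloor>x * g n j\<rfloor> \<le> n) sequentially"
proof -
  have "(\<lambda>n. x * (g n j / real (N n j))) \<longlonglongrightarrow> x * 0"
    by (intro tendsto_intros g_over_N_tendsto_0 j)
  then have "eventually (\<lambda>n. x * (g n j / real (N n j)) < 1) sequentially"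
    by (rule order_tendstoD) simp
  then show ?thesis using eventually_ge_at_top[of k]
  proof eventually_elim
    case (elim n)
    have "x * g n j < real (N n j)" using elim N_pos[OF elim(2) j] by (simp add: divide_less_eq)
    then have "x * g n j < real n" using N_le[OF elim(2) j] by linarith
    then show ?case by linarith
  qed
qed

text \<open>The seeds supply about \<open>\<alpha> i * g\<close> nodes without randomness. The other
  nodes with enough marks have mean at least about \<open>w * g\<close>, and the Chernoff bound
  needs this to be a positive multiple of \<open>g\<close>. The case \<open>w = 0\<close> is
  separate: there the target is met with certainty for large \<open>n\<close>.\<close>

lemma round_tail:
  assumes i: "i \<in> {1..k}" and \<theta>: "0 < \<theta>" "\<theta> < 1"
    and x: "\<And>j. j \<in> {1..k} \<Longrightarrow> 0 \<le> x j"
  shows "\<exists>d>0. eventually (\<lambda>n. \<forall>Z. valid_seeds n Z \<longrightarrow>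
    measure_pmf.prob (array_pmf n k (c n) (q n))
      {f. card (activated n k (c n) r Z (\<lambda>j. nat \<lfloor>x j * g n j\<rfloor>) f i) < nat \<lfloor>\<theta> * Phi r k \<alpha> chi i x * g n i\<rfloor>}
    \<le> exp (- d * g n i)) sequentially"
proof -
  define \<tau> where "\<tau> n j = nat \<lfloor>x j * g n j\<rfloor>" for n j
  define s where "s = (\<Sum>j\<in>{1..k}. chi i j * x j)"
  define C where "C = (1 / real r) * (1 - 1 / real r) ^ (r - 1)"
  define w where "w = C * s ^ r"
  have Phi: "Phi r k \<alpha> chi i x = \<alpha> i + w" by (simp add: Phi_def w_def C_def s_def)
  have s0: "s \<ge> 0" using chi_nonneg i x by (auto simp: s_def intro!: sum_nonneg mult_nonneg_nonneg)
  have C: "C > 0" using r by (simp add: C_def)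
  have w0: "w \<ge> 0" using s0 C by (simp add: w_def)
  have \<alpha>0: "\<alpha> i \<ge> 0" and \<alpha>: "(\<lambda>n. real (a n i) / g n i) \<longlonglongrightarrow> \<alpha> i" using a_ratio[OF i] by auto
  define l where "l n = (\<Sum>j\<in>{1..k}. q n i j * real (\<tau> n j))" for n
  have gpos: "eventually (\<lambda>n. \<forall>j\<in>{1..k}. 0 < g n j) sequentially"
    by (intro eventually_ball_finite ballI g_pos) auto
  have l_ratio: "(\<lambda>n. l n / (p n i * g n i)) \<longlonglongrightarrow> s"
  proof -
    have "(\<lambda>n. \<Sum>j\<in>{1..k}. q n i j * g n j / (p n i * g n i) * (real (\<tau> n j) / g n j)) \<longlonglongrightarrow> s"
      unfolding s_def \<tau>_def by (intro tendsto_sum tendsto_mult chi_lim floor_ratio_tendsto i x) auto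
    moreover have "eventually (\<lambda>n. (\<Sum>j\<in>{1..k}. q n i j * g n j / (p n i * g n i) * (real (\<tau> n j) / g n j))
        = l n / (p n i * g n i)) sequentially"
      using gpos by eventually_elim (auto simp: l_def sum_divide_distrib intro!: sum.cong)
    ultimately show ?thesis by (rule Lim_transform_eventually)
  qed
  have l_0: "l \<longlonglongrightarrow> 0"
  proof -
    have "(\<lambda>n. l n / (p n i * g n i) * (p n i * g n i)) \<longlonglongrightarrow> s * 0"
      by (intro tendsto_mult l_ratio pg_tendsto_0 i)
    moreover have "eventually (\<lambda>n. l n / (p n i * g n i) * (p n i * g n i) = l n) sequentially"
      using p_pos[OF i] g_pos[OF i] by eventually_elim simp
    ultimately show ?thesis using Lim_transform_eventually by fastforce
  qed
  \<comment> \<open>Lower bound for the mean number of nonseeds with at least \<open>r\<close>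
    marks, from \<open>mark_prob_ge_small\<close> with \<open>b = p n i\<close>.\<close>
  define m where "m n = (real (N n i) - real (a n i)) * ((1 - l n) * (max 0 (l n - real r * p n i) ^ r / fact r))" for n
  have inv_g: "(\<lambda>n. 1 / g n i) \<longlonglongrightarrow> 0"
    by (rule real_tendsto_divide_at_top[OF tendsto_const g_at_top[OF i]])
  have m_ratio: "(\<lambda>n. m n / g n i) \<longlonglongrightarrow> w"
  proof -
    \<comment> \<open>Dividing the truncated mean by \<open>p * g\<close> turns the shift
      \<open>r * p\<close> into \<open>r / g\<close>, which vanishes.\<close>
    have "(\<lambda>n. (1 - real (a n i) / real (N n i)) * (1 - l n)
        * (max 0 (l n / (p n i * g n i) - real r * (1 / g n i))) ^ r * C) \<longlonglongrightarrow> (1 - 0) * (1 - 0) * (max 0 (s - real r * 0)) ^ r * C"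
      by (intro tendsto_intros a_over_N_tendsto_0 i l_0 l_ratio inv_g)
    moreover have "eventually (\<lambda>n. (1 - real (a n i) / real (N n i)) * (1 - l n)
        * (max 0 (l n / (p n i * g n i) - real r * (1 / g n i))) ^ r * C = m n / g n i) sequentially"
      using g_identity[OF i] p_pos[OF i] g_pos[OF i] eventually_ge_at_top[of k]
    proof eventually_elim
      case (elim n)
      have N1: "real (N n i) > 0" using N_pos[OF elim(4) i] by simp
      have pg: "p n i * g n i > 0" using elim by simp
      let ?v = "l n / (p n i * g n i) - real r * (1 / g n i)"
      have "l n - real r * p n i = (p n i * g n i) * ?v"
        using elim by (simp add: right_diff_distrib)
      then have "max 0 (l n - real r * p n i) = (p n i * g n i) * max 0 ?v"
        using pg by (simp add: max_mult_distrib_left)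
      then have pw: "max 0 (l n - real r * p n i) ^ r = (p n i ^ r * g n i ^ (r - 1)) * g n i * max 0 ?v ^ r"
        using r by (cases r) (auto simp: power_mult_distrib)
      have fr: "(fact r :: real) = real r * fact (r - 1)" using r by (simp add: fact_reduce)
      have "C = real (N n i) * p n i ^ r * g n i ^ (r - 1) / fact r"
        unfolding elim(1) fr using r by (simp add: C_def)
      then have "real (N n i) * max 0 (l n - real r * p n i) ^ r / fact r = C * g n i * max 0 ?v ^ r"
        unfolding pw by simp
      moreover have "m n = (1 - real (a n i) / real (N n i)) * (1 - l n) * (real (N n i) * max 0 (l n - real r * p n i) ^ r / fact r)"
        using N1 by (simp add: m_def field_simps)
      ultimately have "m n = (1 - real (a n i) / real (N n i)) * (1 - l n) * (C * g n i * max 0 ?v ^ r)"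
        by simp
      then show ?case using elim(3) by simp
    qed
    ultimately show ?thesis using s0 Lim_transform_eventually by (fastforce simp: w_def mult.commute)
  qed
  show ?thesis
  proof (cases "w = 0")
    case True
    have "eventually (\<lambda>n. \<forall>Z. valid_seeds n Z \<longrightarrow>
      measure_pmf.prob (array_pmf n k (c n) (q n))
        {f. card (activated n k (c n) r Z (\<tau> n) f i) < nat \<lfloor>\<theta> * Phi r k \<alpha> chi i x * g n i\<rfloor>}
      \<le> exp (- 1 * g n i)) sequentially"
    proof (cases "\<alpha> i = 0")
      case \<alpha>: True
      show ?thesis using g_pos[OF i] by eventually_elim (simp add: Phi True \<alpha>)
    next
      case False
      then have "\<theta> * \<alpha> i < \<alpha> i" using \<theta> \<alpha>0 by simp
      then have "eventually (\<lambda>n. \<theta> * \<alpha> i < real (a n i) / g n i) sequentially"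
        using \<alpha> by (rule order_tendstoD(1)[rotated])
      then show ?thesis using g_pos[OF i]
      proof eventually_elim
        case (elim n)
        have "\<theta> * \<alpha> i * g n i < real (a n i)" using elim by (simp add: less_divide_eq)
        then have *: "nat \<lfloor>\<theta> * Phi r k \<alpha> chi i x * g n i\<rfloor> \<le> a n i"
          unfolding Phi True by (simp add: nat_le_iff floor_le_iff)
        show ?case
        proof (intro allI impI)
          fix Z assume "valid_seeds n Z"
          then have "{f. card (activated n k (c n) r Z (\<tau> n) f i) < nat \<lfloor>\<theta> * Phi r k \<alpha> chi i x * g n i\<rfloor>} = {}"
            using * i by (auto simp: card_activated valid_seeds_def not_less)
          then show "measure_pmf.prob (array_pmf n k (c n) (q n))
              {f. card (activated n k (c n) r Z (\<tau> n) f i) < nat \<lfloor>\<theta> * Phi r k \<alpha> chi i x * g n i\<rfloor>}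
              \<le> exp (- 1 * g n i)" by simp
        qed
      qed
    qed
    then show ?thesis unfolding \<tau>_def by (intro exI[of _ 1]) simp
  next
    case False
    then have w: "w > 0" using w0 by simp
    \<comment> \<open>Half of the slack \<open>1 - \<theta>\<close>; as \<open>w > 0\<close>, the
      target stays strictly below \<open>\<alpha> i + (1 - \<delta>) * w\<close> in the
      limit.\<close>
    define \<delta> where "\<delta> = (1 - \<theta>) / 2"
    have \<delta>: "\<delta> > 0" "1 - \<delta> > \<theta>" "\<delta> < 1" using \<theta> by (auto simp: \<delta>_def field_simps)
    have "(\<lambda>n. real (a n i) / g n i + (1 - \<delta>) * (m n / g n i)) \<longlonglongrightarrow> \<alpha> i + (1 - \<delta>) * w"
      by (intro tendsto_intros \<alpha> m_ratio)
    moreover have "\<theta> * (\<alpha> i + w) < \<alpha> i + (1 - \<delta>) * w"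
    proof -
      have "\<theta> * \<alpha> i \<le> \<alpha> i" using \<theta> \<alpha>0 by (simp add: mult_left_le_one_le)
      moreover have "\<theta> * w < (1 - \<delta>) * w" using \<delta> w by simp
      ultimately show ?thesis by (simp add: distrib_left)
    qed
    ultimately have ev1: "eventually (\<lambda>n. \<theta> * (\<alpha> i + w) < real (a n i) / g n i + (1 - \<delta>) * (m n / g n i)) sequentially"
      by (rule order_tendstoD)
    have ev2: "eventually (\<lambda>n. w / 2 < m n / g n i) sequentially"
      using m_ratio by (rule order_tendstoD) (use w in simp)
    have ev3: "eventually (\<lambda>n. l n < 1) sequentially"
      using l_0 by (rule order_tendstoD) simp
    have ev4: "eventually (\<lambda>n. \<forall>j\<in>{1..k}. \<tau> n j \<le> n) sequentially"
      unfolding \<tau>_def by (intro eventually_ball_finite ballI floor_le_n x) auto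
    have "eventually (\<lambda>n. \<forall>Z. valid_seeds n Z \<longrightarrow>
      measure_pmf.prob (array_pmf n k (c n) (q n))
        {f. card (activated n k (c n) r Z (\<tau> n) f i) < nat \<lfloor>\<theta> * Phi r k \<alpha> chi i x * g n i\<rfloor>}
      \<le> exp (- (\<delta>\<^sup>2 * w / 4) * g n i)) sequentially"
      using ev1 ev2 ev3 ev4 g_pos[OF i] p_pos[OF i] eventually_ge_at_top[of k]
    proof eventually_elim
      case (elim n)
      show ?case
      proof (intro allI impI)
        fix Z assume Z: "valid_seeds n Z"
        have m0: "w / 2 * g n i < m n" using elim(2,5) by (simp add: less_divide_eq)
        then have "0 \<le> m n" using w elim(5) by (smt (verit) mult_nonneg_nonneg divide_nonneg_nonneg)
        have "(1 - l n) * (max 0 (l n - real r * p n i) ^ r / fact r) \<le> mark_prob n k (q n) r (\<tau> n) i"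
        proof (rule mark_prob_ge_small)
          show "0 \<le> q n i j \<and> q n i j \<le> p n i" if "j \<in> {1..k}" for j
            using q_bounds q_le i that elim(7) by simp
          show "p n i \<le> 1" using q_bounds[OF elim(7) i i] by (simp add: p)
        qed (use elim in \<open>auto simp: l_def\<close>)
        then have "m n \<le> real (card (community n (c n) i - Z)) * mark_prob n k (q n) r (\<tau> n) i"
          unfolding m_def real_card_nonseeds[OF Z i elim(7)] using a_le[OF elim(7) i]
          by (intro mult_left_mono) auto
        note tail = activated_tail[OF less_imp_le[OF \<delta>(1)] \<open>0 \<le> m n\<close> this]
        have "\<theta> * (\<alpha> i + w) < (real (a n i) + (1 - \<delta>) * m n) / g n i"
          using elim(1) by (simp add: add_divide_distrib)
        then have low: "\<theta> * (\<alpha> i + w) * g n i < real (a n i) + (1 - \<delta>) * m n"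
          using elim(5) by (simp add: less_divide_eq)
        have "measure_pmf.prob (array_pmf n k (c n) (q n))
            {f. card (activated n k (c n) r Z (\<tau> n) f i) < nat \<lfloor>\<theta> * Phi r k \<alpha> chi i x * g n i\<rfloor>}
          \<le> measure_pmf.prob (array_pmf n k (c n) (q n))
            {f. real (card (activated n k (c n) r Z (\<tau> n) f i)) \<le> real (card (Z \<inter> community n (c n) i)) + (1 - \<delta>) * m n}"
        proof (intro measure_pmf.finite_measure_mono subsetI CollectI)
          fix f assume "f \<in> {f. card (activated n k (c n) r Z (\<tau> n) f i) < nat \<lfloor>\<theta> * Phi r k \<alpha> chi i x * g n i\<rfloor>}"
          then have "real (card (activated n k (c n) r Z (\<tau> n) f i)) \<le> \<theta> * (\<alpha> i + w) * g n i"
            unfolding Phi mem_Collect_eq by linarith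
          then show "real (card (activated n k (c n) r Z (\<tau> n) f i)) \<le> real (card (Z \<inter> community n (c n) i)) + (1 - \<delta>) * m n"
            using low Z i by (simp add: valid_seeds_def)
        qed simp
        also have "\<dots> \<le> exp (- (\<delta>\<^sup>2 * m n / 2))" by (rule tail)
        also have "\<dots> \<le> exp (- (\<delta>\<^sup>2 * w / 4) * g n i)"
        proof -
          have "\<delta>\<^sup>2 * (w / 2 * g n i) \<le> \<delta>\<^sup>2 * m n" using m0 by (intro mult_left_mono) auto
          then show ?thesis by (simp add: mult_ac)
        qed
        finally show "measure_pmf.prob (array_pmf n k (c n) (q n))
            {f. card (activated n k (c n) r Z (\<tau> n) f i) < nat \<lfloor>\<theta> * Phi r k \<alpha> chi i x * g n i\<rfloor>}
          \<le> exp (- (\<delta>\<^sup>2 * w / 4) * g n i)" .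
      qed
    qed
    then show ?thesis unfolding \<tau>_def using \<delta> w by (intro exI[of _ "\<delta>\<^sup>2 * w / 4"]) simp
  qed
qed

text \<open>Chosen so that \<open>T \<ge> K * g\<close> implies
  \<open>4 * T \<le> N * mark_prob\<close> as long as \<open>p * T \<le> 1/2\<close>. This rests on
  \<open>((1 - 1/r) * K) ^ (r - 1) \<ge> K / 2 = 8 * r * 2 ^ r\<close>, where \<open>2 ^ r\<close>
  pays for \<open>p * T / 2\<close> in place of \<open>p * T\<close>. Of the factor 4, a factor 2
  covers the removal of the seeds and a factor 2 the Chernoff bound.\<close>

abbreviation K :: real where "K \<equiv> 16 * real r * 2 ^ r"

text \<open>There are three ranges of \<open>T\<close>. While \<open>p * T \<le> 1/2\<close>, the
  probability of \<open>r\<close> marks grows like \<open>T ^ r\<close>, and the choice of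
  \<open>K\<close> makes this win. For larger \<open>T\<close> up to a small multiple of
  \<open>N\<close>, marks reach each node in sufficient number with probability at least
  \<open>c1\<close>. For \<open>T\<close> of order \<open>N\<close> the mean \<open>p * T\<close> is
  so large that nearly all nodes are reached, which beats any
  \<open>T \<le> (1 - \<epsilon>) * N\<close>.\<close>

lemma single_tail:
  assumes i: "i \<in> {1..k}" and \<epsilon>: "0 < \<epsilon>" "\<epsilon> < 1"
  shows "\<exists>d>0. eventually (\<lambda>n. \<forall>Z T. valid_seeds n Z \<longrightarrow> K * g n i \<le> real T \<longrightarrow> real T \<le> (1 - \<epsilon>) * real (N n i) \<longrightarrow>
    measure_pmf.prob (array_pmf n k (c n) (q n))
      {f. card (activated n k (c n) r Z (\<lambda>j. if j = i then T else 0) f i) \<le> T}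
    \<le> exp (- d * g n i)) sequentially"
proof -
  \<comment> \<open>The lower bound \<open>small\<close> at a \<open>T0\<close> with
    \<open>p * T0 / 2 \<ge> 1/8\<close>.\<close>
  define c1 :: real where "c1 = (1/8) ^ r / (2 * fact r)"
  have c1: "c1 > 0" by (simp add: c1_def)
  \<comment> \<open>A mean of at least \<open>L\<close> meets the requirement of
    \<open>mark_prob_ge_large\<close> and leaves a node short of marks with probability at most
    \<open>\<epsilon> / 4\<close>.\<close>
  define L where "L = max (2 * real r) (8 * ln (4 / \<epsilon>))"
  define d where "d = \<epsilon>\<^sup>2 / 16"
  have d: "d > 0" "d \<le> 1" using \<epsilon> power_le_one[of \<epsilon> 2] by (auto simp: d_def)
  have K: "K / 2 * (1 / 8) = real r * 2 ^ r" "K \<ge> 4"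
  proof -
    have "real r * 2 ^ r \<ge> 1 * 1" using r by (intro mult_mono) auto
    then show "K \<ge> 4" by simp
  qed simp
  \<comment> \<open>\<open>2 * r + 1\<close> nodes then have mean below 1/2, so that rounding down
    \<open>1 / (2 * p)\<close> still gives at least \<open>2 * r\<close>.\<close>
  have ev_p: "eventually (\<lambda>n. p n i < 1 / (4 * real r + 2)) sequentially"
    using p_tendsto_0[OF i] by (rule order_tendstoD) (use r in \<open>simp add: add_pos_pos\<close>)
  have ev_a: "eventually (\<lambda>n. real (a n i) / real (N n i) < \<epsilon> / 4) sequentially"
    using a_over_N_tendsto_0[OF i] by (rule order_tendstoD) (use \<epsilon> in simp)
  have ev_g: "eventually (\<lambda>n. g n i / real (N n i) < 1) sequentially"
    using g_over_N_tendsto_0[OF i] by (rule order_tendstoD) simp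
  have ev_g1: "eventually (\<lambda>n. real r \<le> g n i) sequentially"
    using g_at_top[OF i] by (simp add: filterlim_at_top)
  have ev_Np: "eventually (\<lambda>n. 4 * L / c1 \<le> real (N n i) * p n i) sequentially"
    using Np_at_top[OF i] by (simp add: filterlim_at_top)
  have "eventually (\<lambda>n. \<forall>Z T. valid_seeds n Z \<longrightarrow> K * g n i \<le> real T \<longrightarrow> real T \<le> (1 - \<epsilon>) * real (N n i) \<longrightarrow>
    measure_pmf.prob (array_pmf n k (c n) (q n))
      {f. card (activated n k (c n) r Z (\<lambda>j. if j = i then T else 0) f i) \<le> T}
    \<le> exp (- d * g n i)) sequentially"
    using ev_p ev_a ev_g ev_g1 ev_Np g_identity[OF i] p_pos[OF i] eventually_ge_at_top[of k]
  proof eventually_elim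
    case (elim n)
    define t where "t T = (\<lambda>j. if j = i then T else (0::nat))" for T
    have N1: "real (N n i) > 0" using N_pos[OF elim(8) i] by simp
    have Nn: "N n i \<le> n" by (rule N_le[OF elim(8) i])
    have a4: "real (a n i) < \<epsilon> / 4 * real (N n i)" using elim(2) N1 by (simp add: divide_less_eq)
    have gN: "g n i < real (N n i)" using elim(3) N1 by (simp add: divide_less_eq)
    have g1: "g n i \<ge> 1" using elim(4) r by linarith
    have pr: "p n i * (4 * real r + 2) < 1"
      using elim(1) r by (simp add: less_divide_eq add_pos_pos)
    have p1: "p n i \<le> 1 / 8" 
    proof -
      have "p n i * 8 \<le> p n i * (4 * real r + 2)" using r elim(7) by (intro mult_left_mono) auto
      then show ?thesis using pr by simp
    qed
    have sum_t: "(\<Sum>j\<in>{1..k}. q n i j * real (t T j)) = p n i * real T" for T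
    proof -
      have "(\<Sum>j\<in>{1..k}. q n i j * real (t T j)) = (\<Sum>j\<in>{1..k}. if j = i then q n i i * real T else 0)"
        by (intro sum.cong) (auto simp: t_def)
      then show ?thesis using i by (simp add: p)
    qed
    have qb: "0 \<le> q n i j \<and> q n i j \<le> p n i" if "j \<in> {1..k}" for j
      using q_bounds q_le i that elim(8) by simp
    have small: "(p n i * real T / 2) ^ r / (2 * fact r) \<le> mark_prob n k (q n) r (t T) i"
      if T: "2 * real r \<le> real T" "p n i * real T \<le> 1 / 2" "T \<le> n" for T
    proof -
      have "p n i * real T - real r * p n i = p n i * (real T - real r)" by (simp add: algebra_simps)
      moreover have "p n i * (real T / 2) \<le> p n i * (real T - real r)"
        using T elim(7) by (intro mult_left_mono) auto
      ultimately have "p n i * real T / 2 \<le> max 0 (p n i * real T - real r * p n i)" by simp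
      then have "(p n i * real T / 2) ^ r \<le> max 0 (p n i * real T - real r * p n i) ^ r"
        using elim(7) by (intro power_mono) auto
      then have "1 / 2 * ((p n i * real T / 2) ^ r / fact r)
          \<le> (1 - p n i * real T) * (max 0 (p n i * real T - real r * p n i) ^ r / fact r)"
        using T elim(7) by (intro mult_mono divide_right_mono) auto
      also have "\<dots> \<le> mark_prob n k (q n) r (t T) i"
        by (rule mark_prob_ge_small) (use qb p1 elim(7) T sum_t in \<open>auto simp: t_def\<close>)
      finally show ?thesis by simp
    qed
    show ?case
    proof (intro allI impI)
      fix Z T assume Z: "valid_seeds n Z" and T: "K * g n i \<le> real T" "real T \<le> (1 - \<epsilon>) * real (N n i)"
      let ?A = "\<lambda>f. card (activated n k (c n) r Z (t T) f i)"
      let ?P = "measure_pmf.prob (array_pmf n k (c n) (q n))"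
      let ?V = "real (card (community n (c n) i - Z))"
      have V: "?V = real (N n i) - real (a n i)" by (rule real_card_nonseeds[OF Z i elim(8)])
      have Vhalf: "real (N n i) / 2 \<le> ?V"
      proof -
        have "\<epsilon> / 4 * real (N n i) \<le> 1 / 2 * real (N n i)" using \<epsilon> N1 by (intro mult_right_mono) auto
        then show ?thesis unfolding V using a4 by simp
      qed
      have TN: "real T \<le> real (N n i)" using T(2) \<epsilon> N1 by (smt (verit) mult_le_cancel_right1)
      then have Tn: "T \<le> n" using Nn by simp
      have "K * real r \<le> K * g n i" using elim(4) by (intro mult_left_mono) auto
      moreover have "4 * real r \<le> K * real r" using K by (intro mult_right_mono) auto
      ultimately have T2r: "4 * real r \<le> real T" using T(1) by linarith
      have "?P {f. ?A f \<le> T} \<le> exp (- d * g n i)"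
      proof (cases "real T \<le> c1 / 4 * real (N n i)")
        case True
        have "4 * real T \<le> real (N n i) * mark_prob n k (q n) r (t T) i"
        proof (cases "p n i * real T \<le> 1 / 2")
          case pT: True
          have base: "8 * real r * 2 ^ r \<le> ((1 - 1 / real r) * K) ^ (r - 1)"
          proof -
            have h: "1 / 2 \<le> 1 - 1 / real r" using r by (simp add: field_simps)
            have "8 * real r * 2 ^ r = 1 / 2 * K" by simp
            also have "\<dots> \<le> (1 - 1 / real r) * K" using h by (intro mult_right_mono) auto
            finally have le: "8 * real r * 2 ^ r \<le> (1 - 1 / real r) * K" .
            have "1 \<le> 8 * real r * 2 ^ r" using K by simp
            then have "(1 - 1 / real r) * K \<le> ((1 - 1 / real r) * K) ^ (r - 1)"
              by (rule self_le_power[OF order.trans[OF _ le]]) (use r in simp)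
            with le show ?thesis by (rule order.trans)
          qed
          have fr: "(fact r :: real) = real r * fact (r - 1)" using r by (simp add: fact_reduce)
          have Tr: "real T ^ r = real T * real T ^ (r - 1)" using r by (cases r) auto
          have "8 * 2 ^ r * fact r = (8 * real r * 2 ^ r) * fact (r - 1)" unfolding fr by simp
          also have "\<dots> \<le> ((1 - 1 / real r) * K) ^ (r - 1) * fact (r - 1)"
            using base by (rule mult_right_mono) simp
          also have "\<dots> = K ^ (r - 1) * ((1 - 1 / real r) ^ (r - 1) * fact (r - 1))"
            by (simp only: power_mult_distrib mult_ac)
          also have "\<dots> = real (N n i) * p n i ^ r * (K * g n i) ^ (r - 1)"
            unfolding elim(6)[symmetric] by (simp only: power_mult_distrib mult_ac)
          also have "\<dots> \<le> real (N n i) * p n i ^ r * real T ^ (r - 1)"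
            using T(1) g1 elim(7) by (intro mult_left_mono power_mono) auto
          finally have "8 * 2 ^ r * fact r * real T \<le> real (N n i) * p n i ^ r * real T ^ (r - 1) * real T"
            by (rule mult_right_mono) simp
          also have "\<dots> = real (N n i) * (p n i * real T / 2) ^ r * 2 ^ r"
            by (simp add: power_mult_distrib power_divide Tr mult_ac)
          finally have "8 * fact r * real T \<le> real (N n i) * (p n i * real T / 2) ^ r"
            by (simp add: mult_ac)
          then have "4 * real T \<le> real (N n i) * ((p n i * real T / 2) ^ r / (2 * fact r))"
            by (simp add: le_divide_eq mult_ac)
          also have "\<dots> \<le> real (N n i) * mark_prob n k (q n) r (t T) i"
            using T2r pT Tn by (intro mult_left_mono small) auto
          finally show ?thesis .
        next
          case pT: False
          define T0 where "T0 = nat \<lfloor>1 / (2 * p n i)\<rfloor>"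
          have inv: "p n i * (1 / (2 * p n i)) = 1 / 2" using elim(7) by simp
          have "0 \<le> 1 / (2 * p n i)" using elim(7) by simp
          then have T0: "real T0 \<le> 1 / (2 * p n i)" "1 / (2 * p n i) - 1 \<le> real T0"
            unfolding T0_def by linarith+
          have pT0: "p n i * real T0 \<le> 1 / 2" "1 / 2 - p n i \<le> p n i * real T0"
            using mult_left_mono[OF T0(1), of "p n i"] mult_left_mono[OF T0(2), of "p n i"] elim(7) inv
            by (auto simp: right_diff_distrib)
          have "p n i * real T0 < p n i * real T" using pT0 pT by linarith
          then have T0T: "T0 \<le> T" using elim(7) by simp
          have "2 * real r \<le> real T0"
          proof -
            have "p n i * (2 * real r) \<le> 1 / 2 - p n i" using pr by (simp add: algebra_simps)
            then have "p n i * (2 * real r) \<le> p n i * real T0" using pT0 by linarith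
            then show ?thesis using elim(7) by simp
          qed
          have "(1 / 8) ^ r \<le> (p n i * real T0 / 2) ^ r"
            using pT0 p1 by (intro power_mono) auto
          then have "c1 \<le> (p n i * real T0 / 2) ^ r / (2 * fact r)"
            unfolding c1_def by (rule divide_right_mono) simp
          also have "\<dots> \<le> mark_prob n k (q n) r (t T0) i"
            using \<open>2 * real r \<le> real T0\<close> pT0 T0T Tn by (intro small) auto
          also have "\<dots> \<le> mark_prob n k (q n) r (t T) i"
            using T0T by (intro mark_prob_mono) (auto simp: t_def)
          finally have "real (N n i) * c1 \<le> real (N n i) * mark_prob n k (q n) r (t T) i"
            by (intro mult_left_mono) auto
          then show ?thesis using True by (simp add: mult.commute)
        qed
        moreover have "real (N n i) / 2 * mark_prob n k (q n) r (t T) i \<le> ?V * mark_prob n k (q n) r (t T) i"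
          using Vhalf by (intro mult_right_mono) (auto simp: mark_prob_def)
        ultimately have m: "2 * real T \<le> ?V * mark_prob n k (q n) r (t T) i" by simp
        have "?P {f. ?A f \<le> T} \<le> ?P {f. real (?A f) \<le> real (card (Z \<inter> community n (c n) i)) + (1 - 1 / 2) * (2 * real T)}"
          by (intro measure_pmf.finite_measure_mono) auto
        also have "\<dots> \<le> exp (- ((1 / 2)\<^sup>2 * (2 * real T) / 2))"
          by (rule activated_tail[OF _ _ m]) auto
        also have "\<dots> \<le> exp (- d * g n i)"
        proof -
          have "d * g n i \<le> 1 * g n i" using d g1 by (intro mult_right_mono) auto
          moreover have "4 * g n i \<le> K * g n i" using K g1 by (intro mult_right_mono) auto
          ultimately show ?thesis using T(1) by (simp add: power2_eq_square)
        qed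
        finally show ?thesis .
      next
        case False
        have "c1 / 4 * (4 * L / c1) \<le> c1 / 4 * (real (N n i) * p n i)"
          using c1 elim(5) by (intro mult_left_mono) auto
        also have "\<dots> = p n i * (c1 / 4 * real (N n i))" by simp
        also have "\<dots> \<le> p n i * real T" using False elim(7) by (intro mult_left_mono) auto
        finally have "L \<le> p n i * real T" using c1 by simp
        then have l: "2 * real r \<le> p n i * real T" "8 * ln (4 / \<epsilon>) \<le> p n i * real T" by (auto simp: L_def)
        have "exp (- (p n i * real T) / 8) \<le> exp (- ln (4 / \<epsilon>))" using l by simp
        also have "\<dots> = \<epsilon> / 4" using \<epsilon> by (simp add: exp_minus)
        finally have "1 - \<epsilon> / 4 \<le> 1 - exp (- (p n i * real T) / 8)" by simp
        also have "\<dots> \<le> mark_prob n k (q n) r (t T) i"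
        proof (rule mark_prob_ge_large)
          show "0 \<le> q n i j \<and> q n i j \<le> 1" if "j \<in> {1..k}" for j using qb[OF that] p1 by linarith
        qed (use Tn l sum_t in \<open>auto simp: t_def\<close>)
        \<comment> \<open>One factor is for the seeds, one for nodes with too few marks. Their
          product is at least \<open>1 - \<epsilon> / 2\<close>, and a Chernoff loss of
          \<open>\<epsilon> / 2\<close> then still leaves \<open>1 - \<epsilon>\<close>.\<close>
        finally have "(1 - \<epsilon> / 4) * real (N n i) * (1 - \<epsilon> / 4) \<le> ?V * mark_prob n k (q n) r (t T) i"
          using a4 \<epsilon> N1 V by (intro mult_mono) (auto simp: algebra_simps)
        moreover have "(1 - \<epsilon> / 2) * real (N n i) \<le> (1 - \<epsilon> / 4) * real (N n i) * (1 - \<epsilon> / 4)"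
        proof -
          have "1 - \<epsilon> / 2 \<le> (1 - \<epsilon> / 4) * (1 - \<epsilon> / 4)" by (simp add: algebra_simps)
          then have "(1 - \<epsilon> / 2) * real (N n i) \<le> (1 - \<epsilon> / 4) * (1 - \<epsilon> / 4) * real (N n i)"
            using N1 by (intro mult_right_mono) auto
          then show ?thesis by (simp add: mult_ac)
        qed
        ultimately have m: "(1 - \<epsilon> / 2) * real (N n i) \<le> ?V * mark_prob n k (q n) r (t T) i" by linarith
        have "real T \<le> (1 - \<epsilon> / 2) * ((1 - \<epsilon> / 2) * real (N n i))"
        proof -
          have "1 - \<epsilon> \<le> (1 - \<epsilon> / 2) * (1 - \<epsilon> / 2)" by (simp add: algebra_simps)
          then have "(1 - \<epsilon>) * real (N n i) \<le> (1 - \<epsilon> / 2) * (1 - \<epsilon> / 2) * real (N n i)"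
            using N1 by (intro mult_right_mono) auto
          then show ?thesis using T(2) by (simp add: mult.assoc)
        qed
        then have "?P {f. ?A f \<le> T} \<le> ?P {f. real (?A f) \<le> real (card (Z \<inter> community n (c n) i)) + (1 - \<epsilon> / 2) * ((1 - \<epsilon> / 2) * real (N n i))}"
          by (intro measure_pmf.finite_measure_mono) auto
        also have "\<dots> \<le> exp (- ((\<epsilon> / 2)\<^sup>2 * ((1 - \<epsilon> / 2) * real (N n i)) / 2))"
          by (rule activated_tail[OF _ _ m]) (use \<epsilon> in auto)
        also have "\<dots> \<le> exp (- d * g n i)"
        proof -
          have "1 / 2 * g n i \<le> (1 - \<epsilon> / 2) * real (N n i)" using \<epsilon> gN g1 by (intro mult_mono) auto
          then have "\<epsilon>\<^sup>2 * (1 / 2 * g n i) \<le> \<epsilon>\<^sup>2 * ((1 - \<epsilon> / 2) * real (N n i))" by (intro mult_left_mono) auto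
          then show ?thesis by (simp add: d_def power_divide)
        qed
        finally show ?thesis .
      qed
      then show "?P {f. card (activated n k (c n) r Z (\<lambda>j. if j = i then T else 0) f i) \<le> T} \<le> exp (- d * g n i)"
        by (simp add: t_def)
    qed
  qed
  then show ?thesis using d by blast
qed

text \<open>If no round fails, \<open>\<tau> l \<le> t\<close> follows by induction on
  \<open>l\<close>, because the stuck vector \<open>t\<close> bounds the sizes of
  \<open>activated\<close> and these are monotone. Then \<open>t i \<ge> K * g\<close>, and
  replacing the other coordinates by 0 leaves an event about one community, which is excluded for
  each possible value of \<open>t i\<close>.\<close>

lemma stuck_tail:
  assumes irr: "irreducible_matrix k chi" and super: "min_rho r k \<alpha> chi > 0" and \<epsilon>: "0 < \<epsilon>" "\<epsilon> < 1"
  shows "\<exists>b. summable b \<and> eventually (\<lambda>n. \<forall>Z. valid_seeds n Z \<longrightarrow>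
    measure_pmf.prob (array_pmf n k (c n) (q n))
      {f. \<exists>t. (\<exists>i\<in>{1..k}. real (t i) < (1 - \<epsilon>) * real (N n i))
           \<and> (\<forall>i. card (activated n k (c n) r Z t f i) \<le> t i)} \<le> b n) sequentially"
proof -
  interpret critical_system r k \<alpha> chi
    by unfold_locales (use r k a_ratio chi_nonneg chi_self in blast)+
  \<comment> \<open>One unit more than \<open>K\<close> absorbs the rounding in
    \<open>\<tau>\<close>, since eventually \<open>g \<ge> 1\<close>.\<close>
  obtain \<theta> m where \<theta>: "0 < \<theta>" "\<theta> < 1" and large: "\<And>i. i \<in> {1..k} \<Longrightarrow> K + 1 < iterate r k \<alpha> chi \<theta> m i"
    using damped_iterate_large[OF irr super] by metis
  define Y where "Y = iterate r k \<alpha> chi \<theta>"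
  define \<tau> where "\<tau> l n j = nat \<lfloor>Y l j * g n j\<rfloor>" for l n j
  define F where "F l i n Z = {f. card (activated n k (c n) r Z (\<tau> l n) f i) < \<tau> (Suc l) n i}" for l i n Z
  \<comment> \<open>The coordinate \<open>t i\<close> is not known in advance, so all integers it
    can equal are listed; there are at most \<open>n + 1\<close>.\<close>
  define R where "R i n = {T. T \<le> n \<and> K * g n i \<le> real T \<and> real T \<le> (1 - \<epsilon>) * real (N n i)}" for i n
  define G where "G i n Z T = {f. card (activated n k (c n) r Z (\<lambda>j. if j = i then T else 0) f i) \<le> T}" for i n Z T
  let ?P = "\<lambda>n. measure_pmf.prob (array_pmf n k (c n) (q n))"
  define P1 where "P1 l i d \<longleftrightarrow> d > 0 \<and>
    eventually (\<lambda>n. \<forall>Z. valid_seeds n Z \<longrightarrow> ?P n (F l i n Z) \<le> exp (- d * g n i)) sequentially" for l i d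
  define P2 where "P2 i d \<longleftrightarrow> d > 0 \<and>
    eventually (\<lambda>n. \<forall>Z. valid_seeds n Z \<longrightarrow> (\<forall>T\<in>R i n. ?P n (G i n Z T) \<le> exp (- d * g n i))) sequentially" for i d
  have exP1: "\<exists>d. P1 l i d" if i: "i \<in> {1..k}" for l i
  proof -
    have "\<And>j. j \<in> {1..k} \<Longrightarrow> 0 \<le> Y l j"
      unfolding Y_def using iterate_nonneg \<theta>(1) by (meson less_imp_le)
    from round_tail[OF i \<theta>, where x = "Y l", OF this] show ?thesis
      unfolding P1_def F_def \<tau>_def Y_def iterate.simps by blast
  qed
  define d1 where "d1 l i = (SOME d. P1 l i d)" for l i
  have d1: "P1 l i (d1 l i)" if "i \<in> {1..k}" for l i
    unfolding d1_def using exP1[OF that] by (rule someI_ex)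
  have exP2: "\<exists>d. P2 i d" if i: "i \<in> {1..k}" for i
  proof -
    from single_tail[OF i \<epsilon>] obtain d where d: "d > 0" "eventually (\<lambda>n. \<forall>Z T. valid_seeds n Z \<longrightarrow> K * g n i \<le> real T \<longrightarrow> real T \<le> (1 - \<epsilon>) * real (N n i) \<longrightarrow>
       ?P n {f. card (activated n k (c n) r Z (\<lambda>j. if j = i then T else 0) f i) \<le> T} \<le> exp (- d * g n i)) sequentially"
      by blast
    from d(2) have "eventually (\<lambda>n. \<forall>Z. valid_seeds n Z \<longrightarrow> (\<forall>T\<in>R i n. ?P n (G i n Z T) \<le> exp (- d * g n i))) sequentially"
      by (rule eventually_mono) (simp add: R_def G_def)
    then show ?thesis using d(1) by (auto simp: P2_def)
  qed
  define d2 where "d2 i = (SOME d. P2 i d)" for i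
  have d2: "P2 i (d2 i)" if "i \<in> {1..k}" for i
    unfolding d2_def using exP2[OF that] by (rule someI_ex)
  define b where "b n = (\<Sum>l<m. \<Sum>i\<in>{1..k}. real (Suc n) * exp (- d1 l i * g n i))
    + (\<Sum>i\<in>{1..k}. real (Suc n) * exp (- d2 i * g n i))" for n
  have "summable b"
    unfolding b_def using d1 d2 by (intro summable_add summable_sum summable_exp_g) (auto simp: P1_def P2_def)
  moreover have "eventually (\<lambda>n. \<forall>Z. valid_seeds n Z \<longrightarrow>
    ?P n {f. \<exists>t. (\<exists>i\<in>{1..k}. real (t i) < (1 - \<epsilon>) * real (N n i))
           \<and> (\<forall>i. card (activated n k (c n) r Z t f i) \<le> t i)} \<le> b n) sequentially"
  proof -
    have "eventually (\<lambda>n. \<forall>l\<in>{..<m}. \<forall>i\<in>{1..k}. \<forall>Z. valid_seeds n Z \<longrightarrow> ?P n (F l i n Z) \<le> exp (- d1 l i * g n i)) sequentially"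
      using d1 unfolding P1_def by (intro eventually_ball_finite ballI) blast+
    moreover have "eventually (\<lambda>n. \<forall>i\<in>{1..k}. \<forall>Z. valid_seeds n Z \<longrightarrow> (\<forall>T\<in>R i n. ?P n (G i n Z T) \<le> exp (- d2 i * g n i))) sequentially"
      using d2 unfolding P2_def by (intro eventually_ball_finite ballI) blast+
    moreover have "eventually (\<lambda>n. \<forall>i\<in>{1..k}. 1 \<le> g n i) sequentially"
      using g_at_top by (intro eventually_ball_finite ballI) (auto simp: filterlim_at_top)
    ultimately show ?thesis using eventually_ge_at_top[of k]
    proof eventually_elim
      case (elim n)
      show ?case
      proof (intro allI impI)
        fix Z assume Z: "valid_seeds n Z"
        let ?B = "{f. \<exists>t. (\<exists>i\<in>{1..k}. real (t i) < (1 - \<epsilon>) * real (N n i))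
           \<and> (\<forall>i. card (activated n k (c n) r Z t f i) \<le> t i)}"
        have finR: "finite (R i n)" "card (R i n) \<le> Suc n" for i
        proof -
          have sub: "R i n \<subseteq> {..n}" by (auto simp: R_def)
          then show "finite (R i n)" by (rule finite_subset) simp
          show "card (R i n) \<le> Suc n" using card_mono[OF _ sub] by simp
        qed
        have "?B \<subseteq> (\<Union>l<m. \<Union>i\<in>{1..k}. F l i n Z) \<union> (\<Union>i\<in>{1..k}. \<Union>T\<in>R i n. G i n Z T)"
        proof (intro subsetI, rule ccontr)
          fix f assume "f \<in> ?B"
          then obtain t i where i: "i \<in> {1..k}" "real (t i) < (1 - \<epsilon>) * real (N n i)"
            and t: "\<And>i. card (activated n k (c n) r Z t f i) \<le> t i" by blast
          assume "f \<notin> (\<Union>l<m. \<Union>i\<in>{1..k}. F l i n Z) \<union> (\<Union>i\<in>{1..k}. \<Union>T\<in>R i n. G i n Z T)"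
          then have nF: "\<And>l i. \<lbrakk>l < m; i \<in> {1..k}\<rbrakk> \<Longrightarrow> f \<notin> F l i n Z"
            and nG: "\<And>i T. \<lbrakk>i \<in> {1..k}; T \<in> R i n\<rbrakk> \<Longrightarrow> f \<notin> G i n Z T" by blast+
          have le: "\<tau> l n j \<le> t j" if "l \<le> m" "j \<in> {1..k}" for l j
            using that
          proof (induction l arbitrary: j)
            case 0
            then show ?case by (simp add: \<tau>_def Y_def)
          next
            case (Suc l)
            have "\<tau> (Suc l) n j \<le> card (activated n k (c n) r Z (\<tau> l n) f j)"
              using nF[of l j] Suc.prems by (simp add: F_def not_less)
            also have "\<dots> \<le> card (activated n k (c n) r Z t f j)"
              using Suc by (intro card_activated_mono) auto
            also have "\<dots> \<le> t j" by (rule t)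
            finally show ?case .
          qed
          have "K * g n i \<le> real (t i)"
          proof -
            have g1: "1 \<le> g n i" using elim(3) i(1) by blast
            then have "(K + 1) * g n i \<le> Y m i * g n i"
              unfolding Y_def by (intro mult_right_mono less_imp_le[OF large[OF i(1)]]) simp
            moreover have "Y m i * g n i < real (\<tau> m n i) + 1" unfolding \<tau>_def by linarith
            moreover have "(K + 1) * g n i = K * g n i + g n i" by (simp only: distrib_right mult_1)
            moreover have "real (\<tau> m n i) \<le> real (t i)" using le[of m i] i(1) by simp
            ultimately show ?thesis using g1 by linarith
          qed
          moreover have "t i \<le> n"
          proof -
            have "(1 - \<epsilon>) * real (N n i) \<le> 1 * real (N n i)"
              using \<epsilon> by (intro mult_right_mono) auto
            then have "real (t i) \<le> real (N n i)" using i(2) by linarith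
            then show ?thesis using N_le[OF elim(4) i(1)] by simp
          qed
          ultimately have "t i \<in> R i n" using i(2) by (simp add: R_def)
          then have "t i < card (activated n k (c n) r Z (\<lambda>j. if j = i then t i else 0) f i)"
            using nG[OF i(1), of "t i"] by (simp add: G_def not_le)
          also have "\<dots> \<le> card (activated n k (c n) r Z t f i)"
            by (intro card_activated_mono) auto
          also have "\<dots> \<le> t i" by (rule t)
          finally show False by simp
        qed
        then have "?P n ?B \<le> ?P n ((\<Union>l<m. \<Union>i\<in>{1..k}. F l i n Z) \<union> (\<Union>i\<in>{1..k}. \<Union>T\<in>R i n. G i n Z T))"
          by (intro measure_pmf.finite_measure_mono) auto
        also have "\<dots> \<le> ?P n (\<Union>l<m. \<Union>i\<in>{1..k}. F l i n Z) + ?P n (\<Union>i\<in>{1..k}. \<Union>T\<in>R i n. G i n Z T)"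
          by (rule measure_Un_le) auto
        also have "?P n (\<Union>l<m. \<Union>i\<in>{1..k}. F l i n Z) \<le> (\<Sum>l<m. ?P n (\<Union>i\<in>{1..k}. F l i n Z))"
          by (rule measure_UNION_le) auto
        also have "\<dots> \<le> (\<Sum>l<m. \<Sum>i\<in>{1..k}. ?P n (F l i n Z))"
          by (intro sum_mono measure_UNION_le) auto
        also have "\<dots> \<le> (\<Sum>l<m. \<Sum>i\<in>{1..k}. real (Suc n) * exp (- d1 l i * g n i))"
        proof (intro sum_mono)
          fix l i assume "l \<in> {..<m}" "i \<in> {1..k}"
          then have "?P n (F l i n Z) \<le> 1 * exp (- d1 l i * g n i)" using elim(1) Z by simp
          also have "\<dots> \<le> real (Suc n) * exp (- d1 l i * g n i)" by (intro mult_right_mono) auto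
          finally show "?P n (F l i n Z) \<le> real (Suc n) * exp (- d1 l i * g n i)" .
        qed
        also have "?P n (\<Union>i\<in>{1..k}. \<Union>T\<in>R i n. G i n Z T) \<le> (\<Sum>i\<in>{1..k}. ?P n (\<Union>T\<in>R i n. G i n Z T))"
          by (rule measure_UNION_le) auto
        also have "\<dots> \<le> (\<Sum>i\<in>{1..k}. real (Suc n) * exp (- d2 i * g n i))"
        proof (intro sum_mono)
          fix i assume i: "i \<in> {1..k}"
          have "?P n (\<Union>T\<in>R i n. G i n Z T) \<le> (\<Sum>T\<in>R i n. ?P n (G i n Z T))"
            using finR by (intro measure_UNION_le) auto
          also have "\<dots> \<le> (\<Sum>T\<in>R i n. exp (- d2 i * g n i))"
            using elim(2) Z i by (intro sum_mono) auto
          also have "\<dots> = real (card (R i n)) * exp (- d2 i * g n i)" by simp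
          also have "\<dots> \<le> real (Suc n) * exp (- d2 i * g n i)"
            using finR(2)[of i] by (intro mult_right_mono) auto
          finally show "?P n (\<Union>T\<in>R i n. G i n Z T) \<le> real (Suc n) * exp (- d2 i * g n i)" .
        qed
        finally show "?P n ?B \<le> b n" by (simp add: b_def)
      qed
    qed
  qed
  ultimately show ?thesis by blast
qed

section \<open>Averaging over the seeds, and the Borel-Cantelli lemma\<close>

lemma seeds_valid:
  assumes n: "n \<ge> k" and S: "S \<in> set_pmf (seeds_pmf n k (c n) (a n))"
  shows "valid_seeds n (\<Union>i\<in>{1..k}. S i)"
proof -
  have Si: "S i \<subseteq> community n (c n) i \<and> card (S i) = a n i" if i: "i \<in> {1..k}" for i
  proof -
    let ?X = "{T. T \<subseteq> community n (c n) i \<and> card T = a n i}"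
    have "finite ?X" by (rule finite_subset[of _ "Pow (community n (c n) i)"]) auto
    \<comment> \<open>\<open>pmf_of_set\<close> has the intended support only for a nonempty finite
      set; \<open>a \<le> N\<close> ensures this.\<close>
    moreover have "?X \<noteq> {}"
    proof -
      obtain T where "T \<subseteq> community n (c n) i" "card T = a n i"
        using obtain_subset_with_card_n[of "a n i" "community n (c n) i"] a_le[OF n i] N by metis
      then show ?thesis by blast
    qed
    moreover have "S i \<in> set_pmf (pmf_of_set ?X)"
      using S i unfolding seeds_pmf_def by (subst (asm) set_Pi_pmf) (auto simp: PiE_dflt_def)
    ultimately show ?thesis by simp
  qed
  have "(\<Union>j\<in>{1..k}. S j) \<inter> community n (c n) i = S i" if "i \<in> {1..k}" for i
    using Si that by (fastforce simp: community_def)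
  then show ?thesis using Si by (fastforce simp: valid_seeds_def community_def)
qed

text \<open>The seeds are independent of the graph, so a bound uniform in \<open>Z\<close> survives
  averaging. A total below \<open>(1 - \<epsilon>) * n\<close> forces a shortfall in some community,
  since the sizes add up to \<open>n\<close>.\<close>

lemma percolation_tail:
  assumes "irreducible_matrix k chi" "min_rho r k \<alpha> chi > 0" and \<epsilon>: "0 < \<epsilon>" "\<epsilon> < 1"
  shows "\<exists>b. summable b \<and> eventually (\<lambda>n.
    measure_pmf.prob (percolation_pmf n k (c n) (q n) (a n))
      {(h, S). \<not> ((1 - \<epsilon>) * real n \<le> real (card (final_active r n h (\<Union>i\<in>{1..k}. S i)))
                 \<and> card (final_active r n h (\<Union>i\<in>{1..k}. S i)) \<le> n)} \<le> b n) sequentially"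
proof -
  obtain b where b: "summable b" "eventually (\<lambda>n. \<forall>Z. valid_seeds n Z \<longrightarrow>
    measure_pmf.prob (array_pmf n k (c n) (q n))
      {f. \<exists>t. (\<exists>i\<in>{1..k}. real (t i) < (1 - \<epsilon>) * real (N n i))
           \<and> (\<forall>i. card (activated n k (c n) r Z t f i) \<le> t i)} \<le> b n) sequentially"
    using stuck_tail[OF assms] by blast
  from b(2) eventually_ge_at_top[of k]
  have "eventually (\<lambda>n.
    measure_pmf.prob (percolation_pmf n k (c n) (q n) (a n))
      {(h, S). \<not> ((1 - \<epsilon>) * real n \<le> real (card (final_active r n h (\<Union>i\<in>{1..k}. S i)))
                 \<and> card (final_active r n h (\<Union>i\<in>{1..k}. S i)) \<le> n)} \<le> b n) sequentially"
  proof eventually_elim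
    case (elim n)
    show ?case
      unfolding percolation_pmf_def
    proof (rule prob_pair_pmf_le)
      fix S assume S: "S \<in> set_pmf (seeds_pmf n k (c n) (a n))"
      define Z where "Z = (\<Union>i\<in>{1..k}. S i)"
      have Z: "valid_seeds n Z" unfolding Z_def by (rule seeds_valid[OF elim(2) S])
      have Zn: "Z \<subseteq> {..<n}" using Z by (simp add: valid_seeds_def)
      interpret ex: exploration n k r "c n" "q n" Z
        using c q_sym elim(2) Zn by unfold_locales auto
      let ?T = "\<lambda>h i. card (final_active r n h Z \<inter> community n (c n) i)"
      have "(1 - \<epsilon>) * real n \<le> real (card (final_active r n h Z)) \<and> card (final_active r n h Z) \<le> n"
        if h: "\<not> (\<exists>i\<in>{1..k}. real (?T h i) < (1 - \<epsilon>) * real (N n i))" for h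
      proof -
        have sub: "final_active r n h Z \<subseteq> {..<n}" by (rule final_active_bounds[OF Zn])
        have "(1 - \<epsilon>) * real n = (\<Sum>i\<in>{1..k}. (1 - \<epsilon>) * real (N n i))"
          using N_sum[OF elim(2)] by (simp flip: sum_distrib_left of_nat_sum)
        also have "\<dots> \<le> (\<Sum>i\<in>{1..k}. real (?T h i))"
          using h by (intro sum_mono) (auto simp: not_less)
        also have "\<dots> = real (card (\<Union>i\<in>{1..k}. final_active r n h Z \<inter> community n (c n) i))"
          by (subst card_UN_disjoint) (auto simp: community_def)
        also have "(\<Union>i\<in>{1..k}. final_active r n h Z \<inter> community n (c n) i) = final_active r n h Z"
          using sub c[OF elim(2)] by (fastforce simp: community_def)
        finally show ?thesis using card_mono[OF _ sub] by simp
      qed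
      then have "measure_pmf.prob (sbm_pmf n (c n) (q n)) {h. (h, S) \<in>
          {(h, S). \<not> ((1 - \<epsilon>) * real n \<le> real (card (final_active r n h (\<Union>i\<in>{1..k}. S i)))
                 \<and> card (final_active r n h (\<Union>i\<in>{1..k}. S i)) \<le> n)}}
        \<le> measure_pmf.prob (sbm_pmf n (c n) (q n)) {h. \<exists>i\<in>{1..k}. real (?T h i) < (1 - \<epsilon>) * real (N n i)}"
        unfolding Z_def by (intro measure_pmf.finite_measure_mono) (simp_all, blast)
      also have "\<dots> \<le> b n"
        using ex.coupling[of "\<lambda>t. \<exists>i\<in>{1..k}. real (t i) < (1 - \<epsilon>) * real (N n i)"] elim(1) Z
        by (blast intro: order.trans)
      finally show "measure_pmf.prob (sbm_pmf n (c n) (q n)) {h. (h, S) \<in>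
          {(h, S). \<not> ((1 - \<epsilon>) * real n \<le> real (card (final_active r n h (\<Union>i\<in>{1..k}. S i)))
                 \<and> card (final_active r n h (\<Union>i\<in>{1..k}. S i)) \<le> n)}} \<le> b n" .
    qed
  qed
  then show ?thesis using b(1) by blast
qed

text \<open>Only the convergent half of Borel-Cantelli enters, which is valid for any joint law of
  the models.\<close>

lemma almost_percolation:
  assumes M: "prob_space M"
    and meas: "\<And>n. n \<ge> k \<Longrightarrow> (\<lambda>\<omega>. (E n \<omega>, S n \<omega>)) \<in> M \<rightarrow>\<^sub>M count_space UNIV"
    and distr: "\<And>n. n \<ge> k \<Longrightarrow> distr M (count_space UNIV) (\<lambda>\<omega>. (E n \<omega>, S n \<omega>))
             = measure_pmf (percolation_pmf n k (c n) (q n) (a n))"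
    and A: "\<And>n \<omega>. A n \<omega> = card (final_active r n (E n \<omega>) (\<Union>i\<in>{1..k}. S n \<omega> i))"
    and "irreducible_matrix k chi" "min_rho r k \<alpha> chi > 0" and \<epsilon>: "0 < \<epsilon>" "\<epsilon> < 1"
  shows "AE \<omega> in M. eventually (\<lambda>n. (1 - \<epsilon>) * real n \<le> real (A n \<omega>) \<and> A n \<omega> \<le> n) sequentially"
proof -
  interpret prob_space M by (rule M)
  define X where "X n = {(h, S). \<not> ((1 - \<epsilon>) * real n \<le> real (card (final_active r n h (\<Union>i\<in>{1..k}. S i)))
                 \<and> card (final_active r n h (\<Union>i\<in>{1..k}. S i)) \<le> n)}" for n
  obtain b where b: "summable b" "eventually (\<lambda>n.
    measure_pmf.prob (percolation_pmf n k (c n) (q n) (a n)) (X n) \<le> b n) sequentially"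
    using percolation_tail[OF assms(5-8)] unfolding X_def by blast
  \<comment> \<open>Measurability is assumed only for \<open>n \<ge> k\<close>; the finitely many
    other events are replaced by the empty set.\<close>
  define F where "F n = (if n \<ge> k then (\<lambda>\<omega>. (E n \<omega>, S n \<omega>)) -` X n \<inter> space M else {})" for n
  have F[measurable]: "F n \<in> sets M" for n
    unfolding F_def using measurable_sets[OF meas, of n "X n"] by simp
  have "summable (\<lambda>n. measure M (F n))"
  proof (rule summable_comparison_test_ev[OF _ b(1)])
    show "eventually (\<lambda>n. norm (measure M (F n)) \<le> b n) sequentially"
      using b(2) eventually_ge_at_top[of k]
    proof eventually_elim
      case (elim n)
      have "measure M (F n) = measure (distr M (count_space UNIV) (\<lambda>\<omega>. (E n \<omega>, S n \<omega>))) (X n)"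
        using elim(2) by (subst measure_distr[OF meas]) (auto simp: F_def)
      then show ?case using elim distr by simp
    qed
  qed
  then have "AE \<omega> in M. eventually (\<lambda>n. \<omega> \<in> space M - F n) sequentially"
    by (intro borel_cantelli_AE1) (auto simp: emeasure_eq_measure)
  then show ?thesis
  proof eventually_elim
    case (elim \<omega>)
    from elim eventually_ge_at_top[of k] show ?case
    proof eventually_elim
      case (elim n)
      then show ?case by (auto simp: F_def X_def A)
    qed
  qed
qed

end

text \<open>Countably many tolerances, so that almost sure statements for each of them hold
  simultaneously; the double \<open>Suc\<close> keeps each tolerance below 1.\<close>

lemma tendsto_1I:
  fixes x :: "nat \<Rightarrow> real"
  assumes "\<And>m. eventually (\<lambda>n. 1 - 1 / real (Suc (Suc m)) \<le> x n \<and> x n \<le> 1) F"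
  shows "(x \<longlongrightarrow> 1) F"
proof (rule tendstoI)
  fix e :: real assume "e > 0"
  then obtain m where m: "1 / real (Suc m) < e" by (metis nat_approx_posE)
  have "1 / real (Suc (Suc m)) \<le> 1 / real (Suc m)" by (intro divide_left_mono) auto
  then show "eventually (\<lambda>n. dist (x n) 1 < e) F"
    using assms[of m] m by (auto simp: dist_real_def elim!: eventually_mono)
qed

theorem corollary3p5:
  fixes r k :: nat
    and M :: "'w measure"
    and c :: "nat \<Rightarrow> nat \<Rightarrow> nat"
    and N a :: "nat \<Rightarrow> nat \<Rightarrow> nat"
    and q :: "nat \<Rightarrow> nat \<Rightarrow> nat \<Rightarrow> real"
    and p :: "nat \<Rightarrow> nat \<Rightarrow> real"
    and \<alpha> :: "nat \<Rightarrow> real"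
    and \<nu> \<mu> \<gamma> chi :: "nat \<Rightarrow> nat \<Rightarrow> real"
    and E :: "nat \<Rightarrow> 'w \<Rightarrow> (nat \<times> nat \<Rightarrow> bool)"
    and S :: "nat \<Rightarrow> 'w \<Rightarrow> (nat \<Rightarrow> nat set)"
    and A :: "nat \<Rightarrow> 'w \<Rightarrow> nat"
  assumes "r \<ge> 2" and "k \<ge> 1"
    and "\<And>n v. \<lbrakk>n \<ge> k; v < n\<rbrakk> \<Longrightarrow> c n v \<in> {1..k}"
    and "\<And>n i. N n i = card (community n (c n) i)"
    and "\<And>n i. \<lbrakk>n \<ge> k; i \<in> {1..k}\<rbrakk> \<Longrightarrow> N n i \<ge> 1"
    and "\<And>n i j. \<lbrakk>n \<ge> k; i \<in> {1..k}; j \<in> {1..k}\<rbrakk> \<Longrightarrow> q n i j = q n j i"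
    and "\<And>n i j. \<lbrakk>n \<ge> k; i \<in> {1..k}; j \<in> {1..k}\<rbrakk> \<Longrightarrow> 0 \<le> q n i j \<and> q n i j < 1"
    and "\<And>n i. p n i = q n i i"
    and "\<And>n i. \<lbrakk>n \<ge> k; i \<in> {1..k}\<rbrakk> \<Longrightarrow> a n i \<le> N n i"
    and "prob_space M"
    and "\<And>n. n \<ge> k \<Longrightarrow> (\<lambda>\<omega>. (E n \<omega>, S n \<omega>)) \<in> M \<rightarrow>\<^sub>M count_space UNIV"
    and "\<And>n. n \<ge> k \<Longrightarrow>
           distr M (count_space UNIV) (\<lambda>\<omega>. (E n \<omega>, S n \<omega>))
             = measure_pmf (percolation_pmf n k (c n) (q n) (a n))"
    and "\<And>n \<omega>. A n \<omega> = card (final_active r n (E n \<omega>) (\<Union>i\<in>{1..k}. S n \<omega> i))"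
    and "\<And>i j. \<lbrakk>i \<in> {1..k}; j \<in> {1..k}\<rbrakk> \<Longrightarrow>
           (\<lambda>n. real (N n i) / real (N n j)) \<longlonglongrightarrow> \<nu> i j \<and> 0 < \<nu> i j"
    and "\<And>i. i \<in> {1..k} \<Longrightarrow> (\<lambda>n. 1 / real (N n i)) \<in> o(\<lambda>n. p n i)"
    and "\<And>i. i \<in> {1..k} \<Longrightarrow>
           \<exists>r'::real. 1 < r' \<and> r' < real r \<and>
             ((\<lambda>n. p n i) \<in> o(\<lambda>n. real (N n i) powr (- 1 / r')) \<or>
              (\<lambda>n. p n i) \<sim>[at_top] (\<lambda>n. real (N n i) powr (- 1 / r')))"
    and "\<And>n i j. \<lbrakk>n \<ge> k; i \<in> {1..k}; j \<in> {1..k}\<rbrakk> \<Longrightarrow> q n i j \<le> min (p n i) (p n j)"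
    and "\<And>i j. \<lbrakk>i \<in> {1..k}; j \<in> {1..k}\<rbrakk> \<Longrightarrow>
           (\<lambda>n. q n i j / p n i) \<longlonglongrightarrow> \<gamma> i j \<and> \<gamma> i j \<in> {0..1}"
    and "\<And>i j. \<lbrakk>i \<in> {1..k}; j \<in> {1..k}\<rbrakk> \<Longrightarrow>
           (\<lambda>n. p n i / p n j) \<longlonglongrightarrow> \<mu> i j \<and> 0 < \<mu> i j"
    and "\<And>i. i \<in> {1..k} \<Longrightarrow>
           (\<lambda>n. real (a n i) / critical_seeds r (N n i) (p n i)) \<longlonglongrightarrow> \<alpha> i \<and> 0 \<le> \<alpha> i"
    and "\<And>i j. chi i j =
           lim (\<lambda>n. q n i j * critical_seeds r (N n j) (p n j)
                      / (p n i * critical_seeds r (N n i) (p n i)))"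
    and "irreducible_matrix k chi"
    and "\<And>i j. \<lbrakk>1 \<le> i; i \<le> j; j \<le> k\<rbrakk> \<Longrightarrow> \<alpha> j \<le> \<alpha> i"
    and "0 < \<alpha> 1"
    and "min_rho r k \<alpha> chi > 0"
  shows "AE \<omega> in M. (\<lambda>n. real (A n \<omega>) / real n) \<longlonglongrightarrow> 1"
proof -
  interpret sbm_sequence r k c N a q p \<alpha> \<nu> \<mu> \<gamma> chi
  proof
    fix i assume "i \<in> {1..k}"
    then obtain r' :: real where r': "1 < r'" "r' < real r"
      "(\<lambda>n. p n i) \<in> o(\<lambda>n. real (N n i) powr (- 1 / r')) \<or> (\<lambda>n. p n i) \<sim>[at_top] (\<lambda>n. real (N n i) powr (- 1 / r'))"
      using assms(16) by blast
    \<comment> \<open>Both alternatives, negligible or asymptotically equal, enter only through this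
      order bound.\<close>
    then have "(\<lambda>n. p n i) \<in> O(\<lambda>n. real (N n i) powr (- 1 / r'))"
      using landau_o.small_imp_big asymp_equiv_imp_bigo by blast
    then show "\<exists>r'::real. 1 < r' \<and> r' < real r \<and> (\<lambda>n. p n i) \<in> O(\<lambda>n. real (N n i) powr (- 1 / r'))"
      using r' by blast
  qed (fact assms(1-9) assms(14,15,17-21) | use assms(18) in blast)+
  have "AE \<omega> in M. \<forall>m. eventually (\<lambda>n. (1 - 1 / real (Suc (Suc m))) * real n \<le> real (A n \<omega>) \<and> A n \<omega> \<le> n) sequentially"
    unfolding AE_all_countable
    by (intro allI almost_percolation[OF assms(10-13,22,25)]) auto
  then show ?thesis
  proof eventually_elim
    case (elim \<omega>)
    show ?case
    proof (rule tendsto_1I)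
      fix m
      from elim have "eventually (\<lambda>n. (1 - 1 / real (Suc (Suc m))) * real n \<le> real (A n \<omega>) \<and> A n \<omega> \<le> n) sequentially" by blast
      then show "eventually (\<lambda>n. 1 - 1 / real (Suc (Suc m)) \<le> real (A n \<omega>) / real n \<and> real (A n \<omega>) / real n \<le> 1) sequentially"
        using eventually_gt_at_top[of 0]
        by eventually_elim (auto simp: le_divide_eq divide_le_eq)
    qed
  qed
qed

end
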